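(* Let $(\alpha,\nu)$ be critical data and let $\xi\in\mathcal{M}_F^c$. If $\langle\chi,\xi\rangle<\infty$, then $\bar\mu_\xi(t)$ converges weakly to $\beta_e\langle\chi,\xi\rangle\,\nu_e$ as $t\to\infty$.
   Context: $\mathbb{R}_+=[0,\infty)$. $\mathcal{M}_F$ is the space of finite nonnegative Borel measures on $\mathbb{R}_+$ with the topology of weak convergence; $\langle g,\zeta\rangle=\int_{\mathbb{R}_+}g\,d\zeta$; $\mathbb{1}_A$ is the indicator of $A$, $\mathbb{1}=\mathbb{1}_{\mathbb{R}_+}$, and $\chi(x)=x$. $\mathcal{M}_F^c$ is the set of $\xi\in\mathcal{M}_F$ with $\langle\mathbb{1}_{\{x\}},\xi\rangle=0$ for all $x\in\mathbb{R}_+$ (no atoms). Critical data $(\alpha,\nu)$: $\nu$ is a Borel probability measure on $\mathbb{R}_+$ with $\nu(\{0\})=0$ and $\langle\chi,\nu\rangle<\infty$, and $\alpha=1/\langle\chi,\nu\rangle$. $F$ is the cumulative distribution function of $\nu$. The excess lifetime probability measure $\nu_e$ is the Borel probability measure on $\mathbb{R}_+$ with density $f_e(x)=\alpha(1-F(x))$. Set $\beta_e=1/\langle\chi,\nu_e\rangle$, interpreted as $0$ if $\langle\chi,\nu_e\rangle=\infty$. Let $\mathcal{C}=\{g\in \mathbf{C}_b^1(\mathbb{R}_+): g(0)=0,\ g'(0)=0\}$, where $\mathbf{C}^1_b(\mathbb{R}_+)$ is the set of once continuously differentiable real functions on $\mathbb{R}_+$ that are bounded together with their first derivatives. A fluid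 model solution (for $(\alpha,\nu)$) is a function $\bar\mu:[0,\infty)\to\mathcal{M}_F$ such that: (C1) $\bar\mu(\cdot)$ is continuous; (C2) $\langle\mathbb{1}_{\{0\}},\bar\mu(t)\rangle=0$ for each $t\ge0$; (C3) for each $g\in\mathcal{C}$, $\langle g,\bar\mu(t)\rangle=\langle g,\bar\mu(0)\rangle-\int_0^t\frac{\langle g',\bar\mu(s)\rangle}{\langle\mathbb{1},\bar\mu(s)\rangle}\,ds+\alpha t\langle g,\nu\rangle$ for all $0\le t<t^*$, where $t^*=\inf\{s\ge0:\langle\mathbb{1},\bar\mu(s)\rangle=0\}$; (C4) $\langle\mathbb{1},\bar\mu(t)\rangle=0$ for all $t\ge t^*$. It is known (from earlier work) that for each $\xi\in\mathcal{M}_F^c$ there is a unique fluid model solution $\bar\mu_\xi(\cdot)$ with $\bar\mu_\xi(0)=\xi$; also $\bar\mu_\xi(t)\in\mathcal{M}_F^c$ for all $t$, $\bar\mu_\xi(t)\ne\mathbf{0}$ for all $t$ (so $t^*=\infty$) if $\xi\neq\mathbf{0}$, and $\bar\mu_{\mathbf{0}}(\cdot)\equiv\mathbf{0}$, where $\mathbf{0}$ is the zero measure. *)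

theory Defs
  imports "HOL-Probability.Probability"
begin

abbreviation Rplus_borel :: "real measure" where
  "Rplus_borel \<equiv> restrict_space borel {0..}"

definition finite_measures :: "real measure set" where
  "finite_measures = {\<zeta>. finite_measure \<zeta> \<and> sets \<zeta> = sets Rplus_borel}"

definition pairing :: "(real \<Rightarrow> real) \<Rightarrow> real measure \<Rightarrow> real" where
  "pairing g \<zeta> = (LINT x|\<zeta>. g x)"

text \<open>The pairing of \<open>\<zeta>\<close> with the identity function may be infinite, so it is kept in
  \<^typ>\<open>ennreal\<close>.\<close>

definition first_moment :: "real measure \<Rightarrow> ennreal" where
  "first_moment \<zeta> = (\<integral>\<^sup>+ x. ennreal x \<partial>\<zeta>)"

definition total_mass :: "real measure \<Rightarrow> real" where
  "total_mass \<zeta> = pairing (\<lambda>_. 1) \<zeta>"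

definition continuous_measures :: "real measure set" where
  "continuous_measures =
     {\<xi> \<in> finite_measures. \<forall>x\<ge>0. pairing (indicator {x}) \<xi> = 0}"

definition bounded_continuous :: "(real \<Rightarrow> real) set" where
  "bounded_continuous = {g. continuous_on {0..} g \<and> bounded (g ` {0..})}"

text \<open>The coarsest topology on the finite measures for which all maps
  \<open>\<zeta> \<mapsto> pairing g \<zeta>\<close>, with \<open>g\<close> bounded and continuous, are continuous.\<close>

definition weak_topology :: "real measure topology" where
  "weak_topology = topology_generated_by
     {{\<zeta> \<in> finite_measures. pairing g \<zeta> \<in> U} |g U. g \<in> bounded_continuous \<and> open U}"

lemma topspace_weak_topology: "topspace weak_topology = finite_measures"
proof -
  have "(\<lambda>_. 0) \<in> bounded_continuous"
    by (auto simp: bounded_continuous_def image_constant_conv)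
  then have "finite_measures \<in>
      {{\<zeta> \<in> finite_measures. pairing g \<zeta> \<in> U} |g U. g \<in> bounded_continuous \<and> open U}"
    by (intro CollectI exI[of _ "\<lambda>_. 0"] exI[of _ UNIV]) auto
  then show ?thesis
    by (auto simp: weak_topology_def topology_generated_by_topspace)
qed

lemma limitin_weak_topology:
  assumes "\<And>x. x \<in> S \<Longrightarrow> \<mu> x \<in> finite_measures"
    and "eventually (\<lambda>x. x \<in> S) net"
  shows "limitin weak_topology \<mu> \<zeta> net \<longleftrightarrow>
    \<zeta> \<in> finite_measures \<and>
    (\<forall>g\<in>bounded_continuous. ((\<lambda>x. pairing g (\<mu> x)) \<longlongrightarrow> pairing g \<zeta>) net)"
proof safe
  assume L: "limitin weak_topology \<mu> \<zeta> net"
  show z: "\<zeta> \<in> finite_measures"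
    using L by (simp add: limitin_def topspace_weak_topology)
  fix g assume g: "g \<in> bounded_continuous"
  show "((\<lambda>x. pairing g (\<mu> x)) \<longlongrightarrow> pairing g \<zeta>) net"
  proof (rule topological_tendstoI)
    fix U :: "real set" assume U: "open U" "pairing g \<zeta> \<in> U"
    have "openin weak_topology {\<zeta> \<in> finite_measures. pairing g \<zeta> \<in> U}"
      unfolding weak_topology_def using g U by (intro topology_generated_by_Basis) blast
    with L z U have "\<forall>\<^sub>F x in net. \<mu> x \<in> {\<zeta> \<in> finite_measures. pairing g \<zeta> \<in> U}"
      unfolding limitin_def by blast
    then show "\<forall>\<^sub>F x in net. pairing g (\<mu> x) \<in> U"
      by eventually_elim simp
  qed
next
  assume z: "\<zeta> \<in> finite_measures"
    and g: "\<forall>g\<in>bounded_continuous. ((\<lambda>x. pairing g (\<mu> x)) \<longlongrightarrow> pairing g \<zeta>) net"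
  have "\<zeta> \<in> V \<longrightarrow> (\<forall>\<^sub>F x in net. \<mu> x \<in> V)" if "openin weak_topology V" for V
    using that[unfolded weak_topology_def openin_topology_generated_by_iff]
  proof (induction rule: generate_topology_on.induct)
    case Empty
    then show ?case by simp
  next
    case (Int a b)
    then show ?case by (auto intro: eventually_conj)
  next
    case (UN K)
    show ?case
    proof
      assume "\<zeta> \<in> \<Union>K"
      then obtain k where "k \<in> K" "\<zeta> \<in> k" by blast
      with UN.IH have "\<forall>\<^sub>F x in net. \<mu> x \<in> k" by blast
      then show "\<forall>\<^sub>F x in net. \<mu> x \<in> \<Union>K"
        by eventually_elim (use \<open>k \<in> K\<close> in blast)
    qed
  next
    case (Basis s)
    then obtain h U where s: "s = {\<zeta> \<in> finite_measures. pairing h \<zeta> \<in> U}"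
      "h \<in> bounded_continuous" "open U" by blast
    show ?case
    proof
      assume "\<zeta> \<in> s"
      then have "\<forall>\<^sub>F x in net. pairing h (\<mu> x) \<in> U"
        using g s by (auto intro: topological_tendstoD)
      with assms(2) show "\<forall>\<^sub>F x in net. \<mu> x \<in> s"
        by eventually_elim (use assms(1) s in auto)
    qed
  qed
  then show "limitin weak_topology \<mu> \<zeta> net"
    using z by (simp add: limitin_def topspace_weak_topology)
qed

definition critical_data :: "real \<Rightarrow> real measure \<Rightarrow> bool" where
  "critical_data \<alpha> \<nu> \<longleftrightarrow>
     prob_space \<nu> \<and> sets \<nu> = sets Rplus_borel \<and> measure \<nu> {0} = 0 \<and>
     first_moment \<nu> < \<infinity> \<and> \<alpha> = 1 / enn2real (first_moment \<nu>)"

text \<open>The distribution function is written with \<open>{0..x}\<close> because \<open>\<nu>\<close> lives on the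
  half-line: \<open>{..x}\<close> is not an element of \<^term>\<open>sets Rplus_borel\<close>, so the library
  function for distribution functions on the whole real line would return \<open>0\<close>.\<close>

definition dist_fun :: "real measure \<Rightarrow> real \<Rightarrow> real" where
  "dist_fun \<nu> x = measure \<nu> {0..x}"

definition excess_measure :: "real \<Rightarrow> real measure \<Rightarrow> real measure" where
  "excess_measure \<alpha> \<nu> =
     density (restrict_space lborel {0..}) (\<lambda>x. ennreal (\<alpha> * (1 - dist_fun \<nu> x)))"

definition beta_e :: "real \<Rightarrow> real measure \<Rightarrow> ennreal" where
  "beta_e \<alpha> \<nu> =
     (if first_moment (excess_measure \<alpha> \<nu>) = \<infinity> then 0
      else 1 / first_moment (excess_measure \<alpha> \<nu>))"

text \<open>Derivative on the half-line; one-sided at \<open>0\<close>.\<close>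

definition deriv_plus :: "(real \<Rightarrow> real) \<Rightarrow> real \<Rightarrow> real" where
  "deriv_plus g x = vector_derivative g (at x within {0..})"

definition C1_bounded :: "(real \<Rightarrow> real) set" where
  "C1_bounded =
     {g. g differentiable_on {0..} \<and> continuous_on {0..} (deriv_plus g) \<and>
         bounded (g ` {0..}) \<and> bounded (deriv_plus g ` {0..})}"

definition test_functions :: "(real \<Rightarrow> real) set" where
  "test_functions = {g \<in> C1_bounded. g 0 = 0 \<and> deriv_plus g 0 = 0}"

text \<open>The infimum is taken in \<^typ>\<open>ereal\<close>, so it is \<open>\<infinity>\<close> if the mass never vanishes.\<close>

definition extinction_time :: "(real \<Rightarrow> real measure) \<Rightarrow> ereal" where
  "extinction_time \<mu> = (INF s\<in>{s. 0 \<le> s \<and> total_mass (\<mu> s) = 0}. ereal s)"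

text \<open>A function on \<open>[0, \<infinity>)\<close> is represented by a function on all reals whose values at
  negative arguments are irrelevant. Continuity on \<open>[0, \<infinity>)\<close> includes that the values there
  lie in \<open>finite_measures\<close>.\<close>

definition fluid_model_solution ::
    "real \<Rightarrow> real measure \<Rightarrow> (real \<Rightarrow> real measure) \<Rightarrow> bool" where
  "fluid_model_solution \<alpha> \<nu> \<mu> \<longleftrightarrow>
     continuous_map (top_of_set {0..}) weak_topology \<mu> \<and>
     (\<forall>t\<ge>0. pairing (indicator {0}) (\<mu> t) = 0) \<and>
     (\<forall>g\<in>test_functions. \<forall>t\<ge>0. ereal t < extinction_time \<mu> \<longrightarrow>
        pairing g (\<mu> t) =
          pairing g (\<mu> 0)
          - (LBINT s:{0..t}. pairing (deriv_plus g) (\<mu> s) / total_mass (\<mu> s))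
          + \<alpha> * t * pairing g \<nu>) \<and>
     (\<forall>t\<ge>0. extinction_time \<mu> \<le> ereal t \<longrightarrow> total_mass (\<mu> t) = 0)"

end

theory Submission
  imports Defs
begin

text \<open>Let \<open>S t\<close> be the integral of \<open>1 / total_mass (\<mu> s)\<close> over \<open>{0..t}\<close>. Moving the test function with
  speed \<open>S\<close> turns the fluid equation into
  \<open>\<mu> t (x, \<infinity>) = \<xi> (x + S t, \<infinity>) + \<alpha> \<integral>\<^sub>0\<^sup>t \<nu> (x + S t - S s, \<infinity>) ds\<close>. In the clock \<open>u = S t\<close> the total
  mass \<open>m u\<close> therefore solves the renewal equation \<open>m = z + f * m\<close>, where \<open>f\<close> is the density of the
  excess lifetime distribution and \<open>z u = \<xi> (u, \<infinity>)\<close>. Integrating it gives conservation of workload,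
  \<open>R * m = \<integral> z\<close> with \<open>R\<close> the tail of \<open>f\<close>, so \<open>R * m\<close> tends to the first moment of \<open>\<xi>\<close>. If \<open>m\<close> is close
  to its upper or lower limit at some late time, then by the renewal equation it is close to it on long
  preceding stretches; inserting this into the workload identity shows that both limits equal the first
  moment of \<open>\<xi>\<close> divided by the integral of \<open>R\<close>. The formula for \<open>\<mu> t (x, \<infinity>)\<close> then gives convergence of
  the tails, hence weak convergence.\<close>

section \<open>Renewal equations with a decreasing density\<close>

text \<open>Two features of the excess density carry the renewal part. It is decreasing, hence
  bounded below by a positive constant on some interval [0, a]: an almost extremal value at u forces
  almost extremal values on all of [u - a, u], and iteration covers any fixed stretch. It is also
  Lipschitz in the L1 sense under shifts, so \<open>f * m\<close> is Lipschitz although nothing is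
  known about the regularity of \<open>m\<close>; the limit argument is run on \<open>f * m\<close>,
  which differs from \<open>m\<close> only by \<open>z\<close>. The workload identity is used twice:
  it gives the a priori bound on \<open>m\<close>, without which the extremal limits could be
  infinite, and it identifies these limits. On the fluid side the obstacle is that the equation is
  given only before extinction and only for C1 test functions that are flat at 0. Extinction
  therefore has to be excluded first, and the indicator of (x, infinity) is reached only as a limit
  of smooth steps.\<close>

lemma bounded_limsup_sequence:
  fixes m :: "real \<Rightarrow> real"
  assumes B: "\<And>x. \<bar>m x\<bar> \<le> B"
  obtains M u where "filterlim u at_top sequentially" "(\<lambda>n. m (u n)) \<longlonglongrightarrow> M"
    "\<And>\<epsilon>. \<epsilon> > 0 \<Longrightarrow> \<forall>\<^sub>F x in at_top. m x \<le> M + \<epsilon>"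
proof -
  \<comment> \<open>The infimum of the eventual upper bounds is the limit superior at
    infinity.\<close>
  define C where "C = {c. \<forall>\<^sub>F x in at_top. m x \<le> c}"
  have ne: "B \<in> C"
    using B by (auto simp: C_def abs_le_iff)
  have bdd: "-B \<le> c" if c: "c \<in> C" for c
  proof -
    obtain x where "m x \<le> c"
      using eventually_happens[of "\<lambda>x. m x \<le> c" "at_top::real filter"] c by (auto simp: C_def)
    then show ?thesis using B[of x] by (auto simp: abs_le_iff)
  qed
  define M where "M = Inf C"
  have up: "\<forall>\<^sub>F x in at_top. m x \<le> M + \<epsilon>" if "\<epsilon> > 0" for \<epsilon>
  proof -
    have "\<exists>c\<in>C. c < M + \<epsilon>"
      using cInf_lessD[of C "M + \<epsilon>"] ne that by (auto simp: M_def)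
    then obtain c where "c \<in> C" "c < M + \<epsilon>" by blast
    then show ?thesis by (auto simp: C_def elim: eventually_mono)
  qed
  have "\<exists>x. x \<ge> real n \<and> \<bar>m x - M\<bar> \<le> 1 / Suc n" for n
  proof -
    \<comment> \<open>Values above M - 1/(n+1) recur arbitrarily late, since this number is no
      eventual bound, while values above M + 1/(n+1) eventually stop. Hence both estimates hold at
      some point beyond n.\<close>
    have "M - 1 / Suc n \<notin> C"
    proof
      assume "M - 1 / Suc n \<in> C"
      then have "M \<le> M - 1 / Suc n"
        unfolding M_def by (rule cInf_lower) (auto intro: bdd)
      moreover have "1 / real (Suc n) > 0" by simp
      ultimately show False by linarith
    qed
    then have "\<exists>\<^sub>F x in at_top. \<not> m x \<le> M - 1 / Suc n"
      by (simp add: C_def not_eventually)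
    moreover have "\<forall>\<^sub>F x in at_top. m x \<le> M + 1 / Suc n \<and> x \<ge> real n"
      using up[of "1 / Suc n"] eventually_ge_at_top[of "real n"]
      by (auto intro: eventually_conj)
    ultimately have "\<exists>\<^sub>F x in at_top. \<not> m x \<le> M - 1 / Suc n \<and> m x \<le> M + 1 / Suc n \<and> x \<ge> real n"
      by (rule frequently_rev_mp[OF _ eventually_mono]) blast
    then show ?thesis
      by (auto dest!: frequently_ex simp: abs_le_iff algebra_simps)
  qed
  then obtain u where u: "\<And>n. u n \<ge> real n" "\<And>n. \<bar>m (u n) - M\<bar> \<le> 1 / Suc n"
    by metis
  have "filterlim u at_top sequentially"
    by (rule filterlim_at_top_mono[OF filterlim_real_sequentially]) (use u in auto)
  moreover have "(\<lambda>n. m (u n)) \<longlonglongrightarrow> M"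
    by (rule LIM_zero_cancel, rule Lim_null_comparison[OF _ LIMSEQ_inverse_real_of_nat])
      (use u(2) in \<open>auto simp: divide_inverse\<close>)
  ultimately show thesis
    using that up by blast
qed

text \<open>The instance in mind is the excess lifetime density. It is extended by 0 to the negative
  axis, so that integrals over the whole line act as one-sided convolutions.\<close>

locale renewal_density =
  fixes f :: "real \<Rightarrow> real"
  assumes f_measurable[measurable]: "f \<in> borel_measurable borel"
    and f_nonneg: "\<And>x. 0 \<le> f x"
    and f_neg: "\<And>x. x < 0 \<Longrightarrow> f x = 0"
    and f_antimono: "\<And>x y. 0 \<le> x \<Longrightarrow> x \<le> y \<Longrightarrow> f y \<le> f x"
    and f_integral: "has_bochner_integral lborel f 1"
begin

lemma f_integrable[simp, intro]: "integrable lborel f"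
  using f_integral by (rule integrable.intros)

lemma f_integral_eq: "(LINT x|lborel. f x) = 1"
  using f_integral by (rule has_bochner_integral_integral_eq)

lemma f_le: "f x \<le> f 0"
  using f_antimono[of 0 x] f_neg[of x] f_nonneg[of 0] by (cases "x < 0") auto

text \<open>Since \<open>f\<close> decreases, one positive value f a bounds \<open>f\<close> from
  below on the whole interval [0, a].\<close>

lemma f_pos: obtains a where "a > 0" "f a > 0"
proof -
  have "\<exists>a>0. f a > 0"
  proof (rule ccontr)
    assume "\<not> ?thesis"
    then have "f x = 0" if "x \<noteq> 0" for x
      using f_neg[of x] f_nonneg[of x] that by (cases "x > 0") (auto simp: less_le)
    then have "AE x in lborel. f x = 0"
      using AE_lborel_singleton[of "0::real"] by (auto elim: AE_mp)
    then have "(LINT x|lborel. f x) = 0"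
      by (rule integral_eq_zero_AE)
    then show False by (simp add: f_integral_eq)
  qed
  then show thesis using that by blast
qed

lemma integrable_f_mult:
  assumes [measurable]: "m \<in> borel_measurable borel" and B: "\<And>x. \<bar>m x\<bar> \<le> B"
  shows "integrable lborel (\<lambda>s. f s * m s)"
proof (rule Bochner_Integration.integrable_bound)
  show "integrable lborel (\<lambda>s. B * f s)" by auto
  show "AE s in lborel. norm (f s * m s) \<le> norm (B * f s)"
    using B f_nonneg
    by (intro AE_I2) (auto simp: abs_mult abs_of_nonneg mult.commute[of B] intro!: mult_left_mono order.trans[OF B abs_ge_self])
qed simp

definition convolution :: "(real \<Rightarrow> real) \<Rightarrow> real \<Rightarrow> real" where
  "convolution m u = (LINT s|lborel. f s * m (u - s))"

lemma integrable_convolution: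
  assumes [measurable]: "m \<in> borel_measurable borel" and B: "\<And>x. \<bar>m x\<bar> \<le> B"
  shows "integrable lborel (\<lambda>s. f s * m (u - s))"
  by (rule integrable_f_mult) (use B in auto)

lemma convolution_bounded:
  assumes [measurable]: "m \<in> borel_measurable borel" and B: "\<And>x. \<bar>m x\<bar> \<le> B"
  shows "\<bar>convolution m u\<bar> \<le> B"
proof -
  have "\<bar>convolution m u\<bar> \<le> (LINT s|lborel. \<bar>f s * m (u - s)\<bar>)"
    unfolding convolution_def by (rule integral_abs_bound)
  also have "\<dots> \<le> (LINT s|lborel. f s * B)"
    using integrable_abs[OF integrable_convolution[OF assms, of u]] B
    by (intro integral_mono) (auto simp: abs_mult f_nonneg intro!: mult_left_mono)
  finally show ?thesis by (simp add: f_integral_eq)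
qed

text \<open>For a decreasing function the L1 distance to its shift telescopes; the only other
  contribution is the jump at 0, of height at most f 0.\<close>

lemma f_shift_diff:
  assumes h: "0 \<le> h"
  shows "integrable lborel (\<lambda>s. \<bar>f (s + h) - f s\<bar>)"
    "(LINT s|lborel. \<bar>f (s + h) - f s\<bar>) \<le> 2 * h * f 0"
proof -
  have sh: "has_bochner_integral lborel (\<lambda>s. f (s + h)) 1"
    using lborel_has_bochner_integral_real_affine_iff[of 1 f 1 h] f_integral
    by (simp add: add.commute)
  then have shi: "integrable lborel (\<lambda>s. f (s + h))" by (rule integrable.intros)
  \<comment> \<open>The difference f s - f (s + h) has the wrong sign only on [-h, 0), where f s =
    0; adding 2 * f (s + h) there corrects it. The uncorrected difference integrates to 1 -
    1.\<close>
  have eq: "\<bar>f (s + h) - f s\<bar> = (f s - f (s + h)) + 2 * (indicator {-h..<0} s * f (s + h))" for s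
  proof -
    consider "s \<ge> 0" | "-h \<le> s" "s < 0" | "s < -h" by linarith
    then show ?thesis
      using f_antimono[of s "s + h"] f_neg[of s] f_neg[of "s + h"] f_nonneg[of "s + h"] h
      by cases auto
  qed
  have i2: "integrable lborel (\<lambda>s. indicator {-h..<0} s * f (s + h))"
    using integrable_mult_indicator[OF _ shi, of "{-h..<0}"] by simp
  have "(LINT s|lborel. indicator {-h..<0} s * f (s + h)) \<le> (LINT s|lborel. indicator {-h..<0} s * f 0)"
    by (intro integral_mono i2 integrable_mult_left)
      (use h in \<open>auto simp: f_le f_nonneg emeasure_lborel_Ico intro!: integrable_real_indicator split: split_indicator\<close>)
  also have "\<dots> = h * f 0" using h by simp
  finally have le: "(LINT s|lborel. indicator {-h..<0} s * f (s + h)) \<le> h * f 0" .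
  show "integrable lborel (\<lambda>s. \<bar>f (s + h) - f s\<bar>)"
    using shi by (intro integrable_abs) auto
  have "(LINT s|lborel. \<bar>f (s + h) - f s\<bar>) =
    1 - 1 + 2 * (LINT s|lborel. indicator {-h..<0} s * f (s + h))"
    unfolding eq using shi i2 has_bochner_integral_integral_eq[OF sh] f_integral_eq by simp
  with le show "(LINT s|lborel. \<bar>f (s + h) - f s\<bar>) \<le> 2 * h * f 0" by simp
qed

lemma convolution_alt: "convolution m u = (LINT v|lborel. f (u - v) * m v)"
  unfolding convolution_def
  by (subst lborel_integral_real_affine[where c="-1" and t=u]) auto

lemma integrable_convolution_alt:
  assumes [measurable]: "m \<in> borel_measurable borel" and B: "\<And>x. \<bar>m x\<bar> \<le> B"
  shows "integrable lborel (\<lambda>v. f (u - v) * m v)"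
  using lborel_integrable_real_affine[OF integrable_convolution[OF assms, of u], of "-1" u] by simp

text \<open>After substitution the shift acts on \<open>f\<close> instead of \<open>m\<close>, so
  the L1 modulus of \<open>f\<close> suffices and \<open>m\<close> need only be bounded and
  measurable.\<close>

lemma convolution_lipschitz:
  assumes [measurable]: "m \<in> borel_measurable borel" and B: "\<And>x. \<bar>m x\<bar> \<le> B"
  shows "\<bar>convolution m u - convolution m u'\<bar> \<le> 2 * B * f 0 * \<bar>u - u'\<bar>"
proof -
  have le: "\<bar>convolution m (x + h) - convolution m x\<bar> \<le> 2 * B * f 0 * h" if h: "0 \<le> h" for x h
  proof -
    have int: "integrable lborel (\<lambda>v. \<bar>f (x - v + h) - f (x - v)\<bar>)"
      using lborel_integrable_real_affine[OF f_shift_diff(1)[OF h], of "-1" x] by simp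
    have "convolution m (x + h) - convolution m x = (LINT v|lborel. (f (x - v + h) - f (x - v)) * m v)"
      unfolding convolution_alt
      by (subst Bochner_Integration.integral_diff[symmetric])
        (use integrable_convolution_alt[OF assms] in \<open>auto simp: algebra_simps\<close>)
    also have "\<bar>\<dots>\<bar> \<le> (LINT v|lborel. \<bar>(f (x - v + h) - f (x - v)) * m v\<bar>)"
      by (rule integral_abs_bound)
    also have "\<dots> \<le> (LINT v|lborel. \<bar>f (x - v + h) - f (x - v)\<bar> * B)"
    proof (rule integral_mono_AE')
      show "integrable lborel (\<lambda>v. \<bar>f (x - v + h) - f (x - v)\<bar> * B)" using int by simp
      show "AE v in lborel. \<bar>(f (x - v + h) - f (x - v)) * m v\<bar> \<le> \<bar>f (x - v + h) - f (x - v)\<bar> * B"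
        using B by (auto simp: abs_mult intro!: mult_left_mono)
      show "AE v in lborel. 0 \<le> \<bar>f (x - v + h) - f (x - v)\<bar> * B"
        using B[of 0] by auto
    qed
    also have "\<dots> = (LINT s|lborel. \<bar>f (s + h) - f s\<bar>) * B"
      by (subst (2) lborel_integral_real_affine[where c="-1" and t=x]) auto
    also have "\<dots> \<le> 2 * h * f 0 * B"
      using f_shift_diff(2)[OF h] B[of 0] by (intro mult_right_mono) auto
    finally show ?thesis by (simp add: algebra_simps)
  qed
  show ?thesis
    using le[of "u - u'" u'] le[of "u' - u" u] by (cases "u \<ge> u'") (auto simp: abs_minus_commute)
qed

lemma convolution_tendsto:
  assumes [measurable]: "m \<in> borel_measurable borel" and B: "\<And>x. \<bar>m x\<bar> \<le> B"
    and lim: "(m \<longlongrightarrow> 0) at_top"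
  shows "(convolution m \<longlongrightarrow> 0) at_top"
proof -
  have "((\<lambda>u. LINT s|lborel. f s * m (u - s)) \<longlongrightarrow> (LINT s|lborel. f s * 0)) at_top"
  proof (rule integral_dominated_convergence_at_top[where w="\<lambda>s. B * f s"])
    show "AE s in lborel. ((\<lambda>u. f s * m (u - s)) \<longlongrightarrow> f s * 0) at_top"
    proof (intro AE_I2 tendsto_mult tendsto_const filterlim_compose[OF lim])
      show "filterlim (\<lambda>u. u - s) at_top at_top" for s :: real
        using filterlim_tendsto_add_at_top[OF tendsto_const filterlim_ident, of "- s"] by simp
    qed
    show "\<forall>\<^sub>F u in at_top. AE s in lborel. norm (f s * m (u - s)) \<le> B * f s"
      using B f_nonneg by (intro always_eventually allI AE_I2) (auto simp: abs_mult mult.commute[of B] intro!: mult_left_mono)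
  qed auto
  then show ?thesis by (simp add: convolution_def[abs_def])
qed

text \<open>A value that nearly maximises \<open>k\<close> is nearly the average of earlier values, so \<open>k\<close> is
  nearly maximal at those earlier values as well.\<close>

lemma limsup_propagates:
  assumes meas[measurable]: "k \<in> borel_measurable borel" and B: "\<And>x. \<bar>k x\<bar> \<le> B"
    and lip: "\<And>x y. \<bar>k x - k y\<bar> \<le> L * \<bar>x - y\<bar>"
    and eq: "((\<lambda>u. k u - convolution k u) \<longlongrightarrow> 0) at_top"
    and up: "\<And>\<epsilon>. \<epsilon> > 0 \<Longrightarrow> \<forall>\<^sub>F x in at_top. k x \<le> M + \<epsilon>"
    and u: "filterlim u at_top sequentially" and M: "(\<lambda>n. k (u n)) \<longlonglongrightarrow> M"
    and v: "v \<ge> 0"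
  shows "(\<lambda>n. k (u n - v)) \<longlonglongrightarrow> M"
proof -
  obtain a where a: "a > 0" "f a > 0" by (rule f_pos)
  have L0: "L \<ge> 0" using lip[of 0 1] by simp
  have step: "(\<lambda>n. k (u n - v)) \<longlonglongrightarrow> M"
    if u: "filterlim u at_top sequentially" and M: "(\<lambda>n. k (u n)) \<longlonglongrightarrow> M"
      and v: "0 \<le> v" "v \<le> a" for u v
  proof -
    \<comment> \<open>I n is the \<open>f\<close>-weighted mean distance between M and the values of
      \<open>k\<close> before u n. Once it tends to 0, the lower bound on \<open>f\<close> and the
      Lipschitz property make the convergence pointwise.\<close>
    define I where "I n = (LINT s|lborel. f s * \<bar>M - k (u n - s)\<bar>)" for n
    have shift: "filterlim (\<lambda>n. u n - s) at_top sequentially" for s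
      using filterlim_tendsto_add_at_top[OF tendsto_const u, of "-s"] by (simp add: add.commute)
    have bM: "\<bar>M - k x\<bar> \<le> \<bar>M\<bar> + B" for x
      using B[of x] by linarith
    have int1: "integrable lborel (\<lambda>s. f s * (M - k (u n - s)))" for n
      by (rule integrable_f_mult[where B="\<bar>M\<bar> + B"]) (use bM in auto)
    have bmax: "\<bar>max (k x - M) 0\<bar> \<le> \<bar>M\<bar> + B" for x
      using bM[of x] by linarith
    have int2: "integrable lborel (\<lambda>s. f s * max (k (u n - s) - M) 0)" for n
      by (rule integrable_f_mult[where B="\<bar>M\<bar> + B"]) (use bmax in auto)
    have pos: "(\<lambda>n. LINT s|lborel. f s * max (k (u n - s) - M) 0) \<longlonglongrightarrow> (LINT s|lborel. f s * 0)"
    proof (rule integral_dominated_convergence[where w="\<lambda>s. (\<bar>M\<bar> + B) * f s"])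
      show "AE s in lborel. (\<lambda>n. f s * max (k (u n - s) - M) 0) \<longlonglongrightarrow> f s * 0"
      proof (intro AE_I2 tendsto_mult tendsto_const)
        fix s
        show "(\<lambda>n. max (k (u n - s) - M) 0) \<longlonglongrightarrow> 0"
        proof (rule tendstoI)
          fix e :: real assume e: "e > 0"
          then have "\<forall>\<^sub>F n in sequentially. k (u n - s) \<le> M + e / 2"
            using filterlim_iff[THEN iffD1, OF shift[of s], rule_format, OF up[of "e / 2"]] by auto
          then show "\<forall>\<^sub>F n in sequentially. dist (max (k (u n - s) - M) 0) 0 < e"
            by eventually_elim (use e in auto)
        qed
      qed
      show "AE s in lborel. norm (f s * max (k (u n - s) - M) 0) \<le> (\<bar>M\<bar> + B) * f s" for n
        using bmax f_nonneg by (auto simp: abs_mult mult.commute[of "\<bar>M\<bar> + B"] intro!: mult_left_mono)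
    qed auto
    have "(\<lambda>n. k (u n) - (k (u n) - convolution k (u n))) \<longlonglongrightarrow> M - 0"
      by (intro tendsto_diff M filterlim_compose[OF eq u])
    then have "(\<lambda>n. M - convolution k (u n)) \<longlonglongrightarrow> M - M"
      by (intro tendsto_intros) simp
    moreover have "(LINT s|lborel. f s * (M - k (u n - s))) = M - convolution k (u n)" for n
      unfolding right_diff_distrib convolution_def
      by (subst Bochner_Integration.integral_diff) (auto simp: f_integral_eq intro!: integrable_convolution B)
    ultimately have av: "(\<lambda>n. LINT s|lborel. f s * (M - k (u n - s))) \<longlonglongrightarrow> 0"
      by simp
    \<comment> \<open>Absolute value = signed value + twice the excess above M. The signed average
      vanishes by the approximate renewal equation, the excess because M bounds \<open>k\<close>
      eventually up to any margin.\<close>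
    have "I n = (LINT s|lborel. f s * (M - k (u n - s))) + 2 * (LINT s|lborel. f s * max (k (u n - s) - M) 0)" for n
    proof -
      have "f s * \<bar>M - y\<bar> = f s * (M - y) + 2 * (f s * max (y - M) 0)" for s y :: real
        by (auto simp: max_def abs_if algebra_simps)
      then show ?thesis
        unfolding I_def using int1 int2 by simp
    qed
    then have I: "I \<longlonglongrightarrow> 0"
      using tendsto_add[OF av tendsto_mult[OF tendsto_const[of 2] pos]]
      by (subst tendsto_cong[OF always_eventually]) auto
    \<comment> \<open>On a window of length \<delta> around v, \<open>k\<close> varies by at most L
      * \<delta> and \<open>f\<close> is at least f a, so the window alone contributes at least f a
      * \<delta> * (distance - L * \<delta>) to I n.\<close>
    have key: "\<bar>M - k (u n - v)\<bar> \<le> I n / (f a * \<delta>) + L * \<delta>" if \<delta>: "0 < \<delta>" "\<delta> \<le> a" for n \<delta>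
    proof -
      \<comment> \<open>The witness is the minimum of v and a - \<delta>: the window starts at v
        unless it would leave [0, a].\<close>
      obtain c where c: "0 \<le> c" "c + \<delta> \<le> a" "c \<le> v" "v \<le> c + \<delta>"
        using v \<delta> that[of "min v (a - \<delta>)"] by (auto simp: min_def split: if_splits)
      have "f a * (\<bar>M - k (u n - v)\<bar> - L * \<delta>) * \<delta> =
          (LINT s|lborel. indicator {c..c + \<delta>} s * (f a * (\<bar>M - k (u n - v)\<bar> - L * \<delta>)))"
        using \<delta> by simp
      also have "\<dots> \<le> I n"
        unfolding I_def
      proof (rule integral_mono)
        show "integrable lborel (\<lambda>s. f s * \<bar>M - k (u n - s)\<bar>)"
          by (rule integrable_f_mult[where B="\<bar>M\<bar> + B"]) (use bM in auto)
        fix s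
        show "indicator {c..c + \<delta>} s * (f a * (\<bar>M - k (u n - v)\<bar> - L * \<delta>)) \<le> f s * \<bar>M - k (u n - s)\<bar>"
        proof (cases "s \<in> {c..c + \<delta>}")
          case True
          have "L * \<bar>(u n - s) - (u n - v)\<bar> \<le> L * \<delta>"
            using True c L0 by (intro mult_left_mono) auto
          then have "\<bar>M - k (u n - v)\<bar> - L * \<delta> \<le> \<bar>M - k (u n - s)\<bar>"
            using lip[of "u n - s" "u n - v"] by linarith
          then have "f a * (\<bar>M - k (u n - v)\<bar> - L * \<delta>) \<le> f a * \<bar>M - k (u n - s)\<bar>"
            using a by (intro mult_left_mono) auto
          also have "\<dots> \<le> f s * \<bar>M - k (u n - s)\<bar>"
            using f_antimono[of s a] True c by (intro mult_right_mono) auto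
          finally show ?thesis using True by simp
        qed (auto simp: f_nonneg)
      qed (use \<delta> in \<open>auto intro!: integrable_real_indicator simp: emeasure_lborel_Icc_eq\<close>)
      finally show ?thesis using a \<delta> by (simp add: field_simps)
    qed
    show ?thesis
    proof (rule tendstoI)
      fix e :: real assume e: "e > 0"
      \<comment> \<open>The term L * \<delta> should use at most half of e; L + 1 instead of L
        avoids dividing by 0.\<close>
      define \<delta> where "\<delta> = min a (e / (2 * (L + 1)))"
      have \<delta>: "0 < \<delta>" "\<delta> \<le> a" using a e L0 by (auto simp: \<delta>_def)
      have "L * \<delta> \<le> (L + 1) * (e / (2 * (L + 1)))"
        using L0 \<delta> by (intro mult_mono) (auto simp: \<delta>_def)
      also have "\<dots> = e / 2" using L0 by (simp add: field_simps)
      finally have Ld: "L * \<delta> \<le> e / 2" .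
      have "(\<lambda>n. I n / (f a * \<delta>)) \<longlonglongrightarrow> 0 / (f a * \<delta>)"
        using a \<delta> by (intro tendsto_intros I) auto
      then have "\<forall>\<^sub>F n in sequentially. I n / (f a * \<delta>) < e / 2"
        using e by (intro order_tendstoD) auto
      then show "\<forall>\<^sub>F n in sequentially. dist (k (u n - v)) M < e"
      proof eventually_elim
        case (elim n)
        then have "\<bar>M - k (u n - v)\<bar> < e"
          using key[OF \<delta>, of n] Ld by linarith
        then show ?case by (simp add: dist_real_def abs_minus_commute)
      qed
    qed
  qed
  \<comment> \<open>A single step reaches back at most a, so a distance v up to j * a takes j steps,
    each starting from the sequence already moved back by v'.\<close>
  have ind: "(\<lambda>n. k (u n - v)) \<longlonglongrightarrow> M" if "0 \<le> v" "v \<le> real j * a" for j v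
    using that
  proof (induction j arbitrary: v)
    case 0
    then show ?case using M by simp
  next
    case (Suc j)
    define v' where "v' = max 0 (v - a)"
    have 1: "(\<lambda>n. k (u n - v')) \<longlonglongrightarrow> M"
      using Suc a by (intro Suc.IH) (auto simp: v'_def algebra_simps)
    have 2: "filterlim (\<lambda>n. u n - v') at_top sequentially"
      using filterlim_tendsto_add_at_top[OF tendsto_const u, of "-v'"] by (simp add: add.commute)
    have "(\<lambda>n. k (u n - v' - (v - v'))) \<longlonglongrightarrow> M"
      using Suc.prems a by (intro step[OF 2 1]) (auto simp: v'_def)
    then show ?case by simp
  qed
  obtain j :: nat where "v / a \<le> real j" using real_arch_simple by blast
  then show ?thesis using v a by (intro ind[of _ j]) (auto simp: field_simps)
qed


section \<open>Workload identity and boundedness for the renewal equation\<close>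

definition tail :: "real \<Rightarrow> real" where
  "tail x = (LINT s|lborel. indicator {x<..} s * f s)"

lemma integrable_indicator_f: "A \<in> sets borel \<Longrightarrow> integrable lborel (\<lambda>s. indicator A s * f s)"
  using integrable_mult_indicator[OF _ f_integrable, of A] by simp

lemma nn_integral_tail: "(\<integral>\<^sup>+s. indicator {x<..} s * ennreal (f s) \<partial>lborel) = ennreal (tail x)"
proof -
  have "(\<integral>\<^sup>+s. indicator {x<..} s * ennreal (f s) \<partial>lborel) = (\<integral>\<^sup>+s. ennreal (indicator {x<..} s * f s) \<partial>lborel)"
    by (intro nn_integral_cong) (auto split: split_indicator)
  also have "\<dots> = ennreal (tail x)"
    unfolding tail_def by (intro nn_integral_eq_integral integrable_indicator_f) (auto simp: f_nonneg)
  finally show ?thesis .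
qed

lemma tail_nonneg: "0 \<le> tail x"
  unfolding tail_def by (intro integral_nonneg_AE) (auto simp: f_nonneg)

lemma tail_antimono: "x \<le> y \<Longrightarrow> tail y \<le> tail x"
  unfolding tail_def
  by (intro integral_mono integrable_indicator_f) (auto simp: f_nonneg split: split_indicator)

lemma tail_split: "1 - tail x = (LINT s|lborel. indicator {..x} s * f s)"
proof -
  have "1 = (LINT s|lborel. indicator {..x} s * f s + indicator {x<..} s * f s)"
    unfolding f_integral_eq[symmetric]
    by (intro Bochner_Integration.integral_cong) (auto split: split_indicator)
  also have "\<dots> = (LINT s|lborel. indicator {..x} s * f s) + tail x"
    unfolding tail_def by (intro Bochner_Integration.integral_add integrable_indicator_f) auto
  finally show ?thesis by simp
qed

lemma nn_integral_one_minus_tail: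
  "(\<integral>\<^sup>+s. indicator {..x} s * ennreal (f s) \<partial>lborel) = ennreal (1 - tail x)"
proof -
  have "(\<integral>\<^sup>+s. indicator {..x} s * ennreal (f s) \<partial>lborel) = (\<integral>\<^sup>+s. ennreal (indicator {..x} s * f s) \<partial>lborel)"
    by (intro nn_integral_cong) (auto split: split_indicator)
  also have "\<dots> = ennreal (1 - tail x)"
    unfolding tail_split by (intro nn_integral_eq_integral integrable_indicator_f) (auto simp: f_nonneg)
  finally show ?thesis .
qed

lemma tail_le_1: "tail x \<le> 1"
proof -
  have "0 \<le> 1 - tail x"
    unfolding tail_split by (intro integral_nonneg_AE) (auto simp: f_nonneg)
  then show ?thesis by simp
qed

lemma tail_measurable[measurable]: "tail \<in> borel_measurable borel"
proof -
  have "(\<lambda>x. - tail x) \<in> borel_measurable borel"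
    by (intro borel_measurable_mono monoI) (auto intro: tail_antimono)
  from borel_measurable_uminus[OF this] show ?thesis by simp
qed

text \<open>Both halves of an interval (0, b] with f b > 0 carry mass at least f b * b / 2.
  Positivity allows division by the tail; a tail below 1 serves as contraction factor in
  \<open>renewal_bounded\<close>.\<close>

lemma tail_strict: obtains a where "a > 0" "0 < tail a" "tail a < 1"
proof -
  obtain b where b: "b > 0" "f b > 0" by (rule f_pos)
  have "f b * (b / 2) = (LINT s|lborel. indicator {b/2<..b} s * f b)"
    using b by simp
  also have "\<dots> \<le> tail (b / 2)"
    unfolding tail_def using b
    by (intro integral_mono integrable_indicator_f)
      (auto simp: f_nonneg emeasure_lborel_Ioc intro!: f_antimono integrable_real_indicator split: split_indicator)
  finally have 1: "f b * (b / 2) \<le> tail (b / 2)" .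
  have "f b * (b / 2) = (LINT s|lborel. indicator {0..b/2} s * f b)"
    using b by simp
  also have "\<dots> \<le> 1 - tail (b / 2)"
    unfolding tail_split using b
    by (intro integral_mono integrable_indicator_f)
      (auto simp: f_nonneg emeasure_lborel_Icc_eq intro!: f_antimono integrable_real_indicator split: split_indicator)
  finally have 2: "f b * (b / 2) \<le> 1 - tail (b / 2)" .
  have "0 < f b * (b / 2)" using b by simp
  then show thesis using that[of "b / 2"] 1 2 b by linarith
qed

text \<open>The integral of \<open>m\<close> over [0, u] is computed twice: by splitting 1 into tail
  (u - v) and 1 - tail (u - v), and by integrating the renewal equation. Both contain the same term
  \<open>?D\<close>, and cancelling it leaves the identity. With values in \<open>ennreal\<close>,
  the exchange of integrals requires no integrability.\<close>

lemma renewal_workload: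
  assumes [measurable]: "m \<in> borel_measurable borel" "z \<in> borel_measurable borel"
    and m0: "\<And>x. 0 \<le> m x" and mneg: "\<And>x. x < 0 \<Longrightarrow> m x = 0"
    and eq: "\<And>y. 0 \<le> y \<Longrightarrow> y \<le> u \<Longrightarrow>
      ennreal (m y) = ennreal (z y) + (\<integral>\<^sup>+s. ennreal (f s * m (y - s)) \<partial>lborel)"
    and fin: "(\<integral>\<^sup>+y. indicator {0..u} y * ennreal (m y) \<partial>lborel) < \<infinity>"
  shows "(\<integral>\<^sup>+s. indicator {0..} s * ennreal (tail s * m (u - s)) \<partial>lborel) =
    (\<integral>\<^sup>+y. indicator {0..u} y * ennreal (z y) \<partial>lborel)" (is "?W = ?Z")
proof -
  let ?A = "\<integral>\<^sup>+y. indicator {0..u} y * ennreal (m y) \<partial>lborel"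
  let ?D = "\<integral>\<^sup>+v. indicator {0..u} v * (ennreal (m v) * ennreal (1 - tail (u - v))) \<partial>lborel"
  have W: "?W = (\<integral>\<^sup>+v. indicator {0..u} v * (ennreal (m v) * ennreal (tail (u - v))) \<partial>lborel)"
  proof -
    have "?W = (\<integral>\<^sup>+v. indicator {0..} (u - v) * ennreal (tail (u - v) * m v) \<partial>lborel)"
      by (subst nn_integral_real_affine[where c="-1" and t=u]) auto
    also have "\<dots> = (\<integral>\<^sup>+v. indicator {0..u} v * (ennreal (m v) * ennreal (tail (u - v))) \<partial>lborel)"
      using mneg by (intro nn_integral_cong)
        (auto simp: ennreal_mult m0 tail_nonneg mult.commute not_le split: split_indicator)
    finally show ?thesis .
  qed
  have "ennreal (tail x) + ennreal (1 - tail x) = 1" for x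
    by (simp add: tail_nonneg tail_le_1 ennreal_plus[symmetric] del: ennreal_plus)
  then have "?A = (\<integral>\<^sup>+v. indicator {0..u} v * (ennreal (m v) * ennreal (tail (u - v))) +
      indicator {0..u} v * (ennreal (m v) * ennreal (1 - tail (u - v))) \<partial>lborel)"
    by (intro nn_integral_cong) (simp add: distrib_left[symmetric])
  then have A1: "?A = ?W + ?D"
    unfolding W by (subst (asm) nn_integral_add) auto
  have "?A = (\<integral>\<^sup>+y. indicator {0..u} y * ennreal (z y) +
      indicator {0..u} y * (\<integral>\<^sup>+s. ennreal (f s * m (y - s)) \<partial>lborel) \<partial>lborel)"
    by (intro nn_integral_cong) (auto simp: eq split: split_indicator)
  also have "\<dots> = ?Z + (\<integral>\<^sup>+y. indicator {0..u} y * (\<integral>\<^sup>+s. ennreal (f s * m (y - s)) \<partial>lborel) \<partial>lborel)"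
    by (intro nn_integral_add) auto
  also have "(\<integral>\<^sup>+y. indicator {0..u} y * (\<integral>\<^sup>+s. ennreal (f s * m (y - s)) \<partial>lborel) \<partial>lborel) =
      (\<integral>\<^sup>+y. \<integral>\<^sup>+v. indicator {0..u} y * ennreal (f (y - v) * m v) \<partial>lborel \<partial>lborel)"
  proof (intro nn_integral_cong)
    fix y
    have "(\<integral>\<^sup>+s. ennreal (f s * m (y - s)) \<partial>lborel) = (\<integral>\<^sup>+v. ennreal (f (y - v) * m v) \<partial>lborel)"
      by (subst nn_integral_real_affine[where c="-1" and t=y]) auto
    then show "indicator {0..u} y * (\<integral>\<^sup>+s. ennreal (f s * m (y - s)) \<partial>lborel) =
      (\<integral>\<^sup>+v. indicator {0..u} y * ennreal (f (y - v) * m v) \<partial>lborel)"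
      by (simp add: nn_integral_cmult)
  qed
  also have "\<dots> = (\<integral>\<^sup>+v. \<integral>\<^sup>+y. indicator {0..u} y * ennreal (f (y - v) * m v) \<partial>lborel \<partial>lborel)"
    by (intro lborel_pair.Fubini') auto
  \<comment> \<open>For fixed v in [0, u], the mass that \<open>f\<close>, started at v, places in
    [0, u] is 1 - tail (u - v); for any other v the integrand vanishes.\<close>
  also have "\<dots> = ?D"
  proof (intro nn_integral_cong)
    fix v
    show "(\<integral>\<^sup>+y. indicator {0..u} y * ennreal (f (y - v) * m v) \<partial>lborel) =
      indicator {0..u} v * (ennreal (m v) * ennreal (1 - tail (u - v)))"
    proof (cases "0 \<le> v \<and> v \<le> u")
      case True
      have "(\<integral>\<^sup>+y. indicator {0..u} y * ennreal (f (y - v) * m v) \<partial>lborel) =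
        (\<integral>\<^sup>+y. ennreal (m v) * (indicator {..u - v} (y - v) * ennreal (f (y - v))) \<partial>lborel)"
        using True f_neg by (intro nn_integral_cong)
          (auto simp: ennreal_mult m0 f_nonneg mult.commute not_le split: split_indicator)
      also have "\<dots> = ennreal (m v) * (\<integral>\<^sup>+y. indicator {..u - v} (y - v) * ennreal (f (y - v)) \<partial>lborel)"
        by (rule nn_integral_cmult) auto
      also have "(\<integral>\<^sup>+y. indicator {..u - v} (y - v) * ennreal (f (y - v)) \<partial>lborel) =
          (\<integral>\<^sup>+s. indicator {..u - v} s * ennreal (f s) \<partial>lborel)"
        by (subst (2) nn_integral_real_affine[where c="1" and t="-v"]) auto
      finally show ?thesis using True by (simp add: nn_integral_one_minus_tail)
    next
      case False
      then have "indicator {0..u} y * ennreal (f (y - v) * m v) = 0" for y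
        using mneg[of v] f_neg[of "y - v"] by (cases "v < 0") (auto split: split_indicator)
      then have "(\<integral>\<^sup>+y. indicator {0..u} y * ennreal (f (y - v) * m v) \<partial>lborel) = (\<integral>\<^sup>+(y::real). 0 \<partial>lborel)"
        by (simp only:)
      then show ?thesis using False by (auto split: split_indicator)
    qed
  qed
  finally have A2: "?A = ?Z + ?D" .
  \<comment> \<open>Cancellation in \<open>ennreal\<close> is valid only for a finite term; the
    finite integral of \<open>m\<close> over [0, u] provides this.\<close>
  have "?D \<noteq> \<top>" using fin A1 by auto
  moreover have "?D + ?W = ?D + ?Z" using trans[OF A1[symmetric] A2] by (simp only: add.commute)
  ultimately show ?thesis unfolding ennreal_add_left_cancel infinity_ennreal_def by blast
qed

text \<open>The convolution is split at lag a. Recent lags are controlled by the workload, because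
  there \<open>f\<close> is at most a constant times \<open>tail\<close>; older lags carry only mass
  tail a < 1. The running supremum S thus satisfies S <= C + tail a * S.\<close>

lemma renewal_bounded:
  assumes [measurable]: "m \<in> borel_measurable borel"
    and m0: "\<And>x. 0 \<le> m x"
    and z: "\<And>y. 0 \<le> z y" "\<And>y. z y \<le> z0" and z0: "0 \<le> z0"
    and mneg: "\<And>x. x < 0 \<Longrightarrow> m x = 0"
    and loc: "\<And>U. \<exists>B. \<forall>x\<le>U. m x \<le> B"
    and eq: "\<And>y. 0 \<le> y \<Longrightarrow>
      ennreal (m y) = ennreal (z y) + (\<integral>\<^sup>+s. ennreal (f s * m (y - s)) \<partial>lborel)"
    and W: "\<And>u. 0 \<le> u \<Longrightarrow>
      (\<integral>\<^sup>+s. indicator {0..} s * ennreal (tail s * m (u - s)) \<partial>lborel) \<le> ennreal w"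
    and w: "0 \<le> w"
  shows "\<exists>B. \<forall>x. m x \<le> B"
proof -
  obtain a where a: "a > 0" "0 < tail a" "tail a < 1" by (rule tail_strict)
  \<comment> \<open>z0 bounds \<open>z\<close>, and f 0 / tail a * w bounds the lags up to a, since
    f s <= f 0 <= f 0 * tail s / tail a there.\<close>
  define C where "C = z0 + f 0 / tail a * w"
  have C: "0 \<le> C" using a z0 w f_nonneg by (simp add: C_def)
  have step: "m y \<le> C + tail a * B" if y: "y \<le> U" and B: "\<And>x. x \<le> U \<Longrightarrow> m x \<le> B" for y U B
  proof (cases "y < 0")
    case True
    have "0 \<le> B" using m0[of y] B[OF y] by linarith
    then show ?thesis using True mneg a C by simp
  next
    case False
    have B0: "0 \<le> B" using m0[of y] B[OF y] by linarith
    have "ennreal (f s * m (y - s)) \<le> ennreal (f 0 / tail a) * (indicator {0..} s * ennreal (tail s * m (y - s)))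
        + ennreal B * (indicator {a<..} s * ennreal (f s))" for s
    proof -
      consider "s < 0" | "0 \<le> s" "s \<le> a" | "a < s" by linarith
      then show ?thesis
      proof cases
        case 2
        have "f s * m (y - s) \<le> f 0 / tail a * (tail s * m (y - s))"
        proof -
          have "f s \<le> f 0 * 1" using f_le by simp
          also have "\<dots> \<le> f 0 * (tail s / tail a)"
            using tail_antimono[of s a] 2 a f_nonneg by (intro mult_left_mono) auto
          finally show ?thesis
            using mult_right_mono[OF _ m0[of "y - s"], of "f s" "f 0 * (tail s / tail a)"] by simp
        qed
        then show ?thesis using 2 a f_nonneg tail_nonneg m0
          by (auto simp: ennreal_mult[symmetric] intro!: ennreal_leI)
      next
        case 3
        have "f s * m (y - s) \<le> B * f s"
          using mult_left_mono[OF B[of "y - s"] f_nonneg[of s]] y 3 a by (simp add: mult.commute)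
        then have "ennreal (f s * m (y - s)) \<le> ennreal B * (indicator {a<..} s * ennreal (f s))"
          using 3 B0 f_nonneg by (auto simp: ennreal_mult[symmetric] intro!: ennreal_leI)
        then show ?thesis by (rule order.trans) (simp add: add_increasing)
      qed (simp add: f_neg)
    qed
    then have "(\<integral>\<^sup>+s. ennreal (f s * m (y - s)) \<partial>lborel) \<le>
      (\<integral>\<^sup>+s. ennreal (f 0 / tail a) * (indicator {0..} s * ennreal (tail s * m (y - s)))
        + ennreal B * (indicator {a<..} s * ennreal (f s)) \<partial>lborel)"
      by (intro nn_integral_mono)
    also have "\<dots> = ennreal (f 0 / tail a) * (\<integral>\<^sup>+s. indicator {0..} s * ennreal (tail s * m (y - s)) \<partial>lborel)
        + ennreal B * (\<integral>\<^sup>+s. indicator {a<..} s * ennreal (f s) \<partial>lborel)"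
      by (simp add: nn_integral_add nn_integral_cmult)
    also have "\<dots> \<le> ennreal (f 0 / tail a) * ennreal w + ennreal B * ennreal (tail a)"
      using False by (intro add_mono mult_left_mono W) (auto simp: nn_integral_tail)
    finally have "ennreal (m y) \<le> ennreal z0 + (ennreal (f 0 / tail a) * ennreal w + ennreal B * ennreal (tail a))"
      using False z by (subst eq) (auto intro!: add_mono ennreal_leI)
    also have "\<dots> = ennreal (C + tail a * B)"
      using a B0 z0 w f_nonneg
      by (simp add: C_def ennreal_mult[symmetric] ennreal_plus[symmetric] mult.commute del: ennreal_plus)
    finally show ?thesis using a B0 C by (subst (asm) ennreal_le_iff) auto
  qed
  have "m x \<le> C / (1 - tail a)" for x
  proof -
    \<comment> \<open>The supremum runs only over {..x}, where local boundedness makes it finite;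
      otherwise the contraction inequality could not be solved for S. The resulting bound does not
      depend on x.\<close>
    define S where "S = (SUP y\<in>{..x}. m y)"
    obtain B where "\<forall>y\<le>x. m y \<le> B" using loc by blast
    then have bdd: "bdd_above (m ` {..x})" by (auto intro!: bdd_aboveI)
    then have le: "m y \<le> S" if "y \<le> x" for y
      unfolding S_def using that by (intro cSUP_upper) auto
    have "S \<le> C + tail a * S"
      unfolding S_def by (rule cSUP_least) (use step[OF _ le] in \<open>auto simp: S_def\<close>)
    then have "S \<le> C / (1 - tail a)" using a by (simp add: field_simps)
    with le[of x] show ?thesis by simp
  qed
  then show ?thesis by blast
qed


section \<open>Convergence of solutions of the renewal equation\<close>

lemma convolution_measurable:
  assumes [measurable]: "m \<in> borel_measurable borel" and B: "\<And>x. \<bar>m x\<bar> \<le> B"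
  shows "convolution m \<in> borel_measurable borel"
  unfolding convolution_def by measurable

text \<open>Along sequences realising the upper or lower limit, all backward translates of
  \<open>m\<close> converge to the same number M. The workload then becomes M times the integral of
  \<open>tail\<close>, which leaves only one possible value for M.\<close>

lemma renewal_limit:
  assumes meas[measurable]: "m \<in> borel_measurable borel"
    and m0: "\<And>x. 0 \<le> m x" and B: "\<And>x. m x \<le> B"
    and eq: "((\<lambda>u. m u - convolution m u) \<longlongrightarrow> 0) at_top"
    and W: "\<And>u. 0 \<le> u \<Longrightarrow>
      (\<integral>\<^sup>+s. indicator {0..} s * ennreal (tail s * m (u - s)) \<partial>lborel) = ennreal (W u)"
    and W0: "\<And>u. 0 \<le> u \<Longrightarrow> 0 \<le> W u" and Wlim: "(W \<longlongrightarrow> w) at_top"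
  shows "(m \<longlongrightarrow> enn2real (ennreal w / (\<integral>\<^sup>+s. indicator {0..} s * ennreal (tail s) \<partial>lborel))) at_top"
    (is "(m \<longlongrightarrow> ?L) at_top")
proof -
  let ?r = "\<integral>\<^sup>+s. indicator {0..} s * ennreal (tail s) \<partial>lborel"
  have Babs: "\<bar>m x\<bar> \<le> B" for x using m0 B by (simp add: abs_of_nonneg)
  have w0: "0 \<le> w"
    by (rule tendsto_lowerbound[OF Wlim eventually_mono[OF eventually_ge_at_top[of 0] W0]]) auto
  obtain a where a: "a > 0" "0 < tail a" by (rule tail_strict)
  have rpos: "?r > 0"
  proof -
    have "0 < ennreal (tail a) * ennreal a" using a by (simp add: ennreal_mult[symmetric])
    also have "\<dots> = (\<integral>\<^sup>+s. ennreal (tail a) * indicator {0..a} s \<partial>lborel)"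
      using a by (simp add: nn_integral_cmult_indicator)
    also have "\<dots> \<le> ?r"
      by (intro nn_integral_mono) (auto intro!: ennreal_leI tail_antimono split: split_indicator)
    finally show ?thesis .
  qed
  \<comment> \<open>This passes to the limit in the workload integral along u n. It serves the upper
    and the lower limit alike.\<close>
  have lim: "M = ?L"
    if u: "filterlim u at_top sequentially" and M: "\<And>v. v \<ge> 0 \<Longrightarrow> (\<lambda>n. m (u n - v)) \<longlonglongrightarrow> M" for u M
  proof -
    have M0: "0 \<le> M"
      using M[of 0] by (rule LIMSEQ_le_const) (use m0 in auto)
    have ev: "\<forall>\<^sub>F n in sequentially. (\<integral>\<^sup>+s. indicator {0..} s * ennreal (tail s * m (u n - s)) \<partial>lborel) = ennreal (W (u n))"
      using filterlim_iff[THEN iffD1, OF u, rule_format, OF eventually_ge_at_top[of 0]]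
      by eventually_elim (rule W)
    have "(\<lambda>n. ennreal (W (u n))) \<longlonglongrightarrow> ennreal w"
      by (intro tendsto_ennrealI filterlim_compose[OF Wlim u])
    then have Wl: "(\<lambda>n. \<integral>\<^sup>+s. indicator {0..} s * ennreal (tail s * m (u n - s)) \<partial>lborel) \<longlonglongrightarrow> ennreal w"
      by (subst tendsto_cong[OF ev])
    have pw: "(\<lambda>n. indicator {0..} s * ennreal (tail s * m (u n - s))) \<longlonglongrightarrow> indicator {0..} s * ennreal (tail s * M)" for s
    proof (cases "0 \<le> s")
      case True
      then show ?thesis
        using tendsto_ennrealI[OF tendsto_mult[OF tendsto_const M[OF True], of "tail s"]] by simp
    qed simp
    have rM: "(\<integral>\<^sup>+s. indicator {0..} s * ennreal (tail s * M) \<partial>lborel) = ?r * ennreal M"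
      by (subst nn_integral_multc[symmetric]) (auto simp: ennreal_mult tail_nonneg M0 mult.assoc)
    show ?thesis
    proof (cases "?r = \<infinity>")
      case True
      \<comment> \<open>Without an integrable majorant Fatou still gives infinity * M <= w, hence M
        = 0, which agrees with w / infinity = 0.\<close>
      have "?r * ennreal M = (\<integral>\<^sup>+s. liminf (\<lambda>n. indicator {0..} s * ennreal (tail s * m (u n - s))) \<partial>lborel)"
        unfolding rM[symmetric] by (intro nn_integral_cong lim_imp_Liminf[symmetric] pw) auto
      also have "\<dots> \<le> liminf (\<lambda>n. \<integral>\<^sup>+s. indicator {0..} s * ennreal (tail s * m (u n - s)) \<partial>lborel)"
        by (intro nn_integral_liminf) auto
      also have "\<dots> = ennreal w"
        by (intro lim_imp_Liminf Wl) auto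
      finally have "M = 0"
        using True M0 by (cases "M = 0") (auto simp: ennreal_top_mult top_unique)
      then show ?thesis using True by (simp add: ennreal_divide_top)
    next
      case False
      \<comment> \<open>Here B * \<open>tail\<close> is an integrable majorant.\<close>
      have "(\<lambda>n. \<integral>\<^sup>+s. indicator {0..} s * ennreal (tail s * m (u n - s)) \<partial>lborel) \<longlonglongrightarrow> ?r * ennreal M"
        unfolding rM[symmetric]
      proof (rule nn_integral_dominated_convergence[where w="\<lambda>s. indicator {0..} s * ennreal (tail s) * ennreal B"])
        show "AE s in lborel. indicator {0..} s * ennreal (tail s * m (u j - s)) \<le> indicator {0..} s * ennreal (tail s) * ennreal B" for j
          using B m0[of "u j - _"] order.trans[OF m0 B]
          by (intro AE_I2) (auto simp: ennreal_mult[symmetric] tail_nonneg intro!: ennreal_leI mult_left_mono split: split_indicator)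
        show "(\<integral>\<^sup>+s. indicator {0..} s * ennreal (tail s) * ennreal B \<partial>lborel) < \<infinity>"
          using False by (subst nn_integral_multc) (auto simp: ennreal_mult_eq_top_iff less_top[symmetric])
      qed (use pw in auto)
      then have "?r * ennreal M = ennreal w" using LIMSEQ_unique Wl by blast
      then have "ennreal M = ennreal w / ?r"
        using rpos False by (metis ennreal_mult_divide_eq infinity_ennreal_def less_irrefl mult.commute)
      then show ?thesis using M0 by (metis enn2real_ennreal)
    qed
  qed
  \<comment> \<open>\<open>m\<close> may be discontinuous, whereas \<open>limsup_propagates\<close>
    requires a Lipschitz function. Its convolution is Lipschitz and has the same limit behaviour, as
    \<open>m\<close> - \<open>k\<close> tends to 0.\<close>
  define k where "k = convolution m"
  have k[measurable]: "k \<in> borel_measurable borel"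
    unfolding k_def by (rule convolution_measurable[OF meas Babs])
  have kB: "\<bar>k x\<bar> \<le> B" for x unfolding k_def by (rule convolution_bounded[OF meas Babs])
  have kL: "\<bar>k x - k y\<bar> \<le> 2 * B * f 0 * \<bar>x - y\<bar>" for x y
    unfolding k_def by (rule convolution_lipschitz[OF meas Babs])
  have mk: "((\<lambda>u. m u - k u) \<longlongrightarrow> 0) at_top" using eq by (simp add: k_def)
  have kk: "((\<lambda>u. k u - convolution k u) \<longlongrightarrow> 0) at_top"
  proof -
    have "\<bar>m x - k x\<bar> \<le> B + B" for x using Babs[of x] kB[of x] by linarith
    then have "(convolution (\<lambda>u. m u - k u) \<longlongrightarrow> 0) at_top"
      by (intro convolution_tendsto[OF _ _ mk, of "B + B"]) auto
    \<comment> \<open>Convolving m - k with \<open>f\<close> gives k - f * k, so \<open>k\<close>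
      inherits the approximate renewal equation from \<open>m\<close>.\<close>
    moreover have "convolution (\<lambda>u. m u - k u) = (\<lambda>u. k u - convolution k u)"
      using integrable_convolution[OF meas Babs] integrable_convolution[OF k kB]
      by (simp add: k_def convolution_def right_diff_distrib fun_eq_iff)
    ultimately show ?thesis by simp
  qed
  have conv: "(\<lambda>n. m (u n - v)) \<longlonglongrightarrow> M"
    if "filterlim u at_top sequentially" "(\<lambda>n. k (u n - v)) \<longlonglongrightarrow> M" for u v M
  proof -
    have "filterlim (\<lambda>n. u n - v) at_top sequentially"
      using filterlim_tendsto_add_at_top[OF tendsto_const that(1), of "-v"] by (simp add: add.commute)
    from tendsto_add[OF filterlim_compose[OF mk this] that(2)] show ?thesis by simp
  qed
  have up: "\<forall>\<^sub>F x in at_top. k x \<le> ?L + e" if "e > 0" for e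
  proof -
    obtain u M where u: "filterlim u at_top sequentially" "(\<lambda>n. k (u n)) \<longlonglongrightarrow> M"
      "\<And>\<epsilon>. \<epsilon> > 0 \<Longrightarrow> \<forall>\<^sub>F x in at_top. k x \<le> M + \<epsilon>"
      by (rule bounded_limsup_sequence[of k B, OF kB]) (rule that, assumption+)
    have "(\<lambda>n. m (u n - v)) \<longlonglongrightarrow> M" if "v \<ge> 0" for v
      by (rule conv[OF u(1) limsup_propagates[OF k kB kL kk u(3,1,2) that]])
    from lim[OF u(1) this] u(3)[OF that] show ?thesis by simp
  qed
  \<comment> \<open>The lower limit of \<open>k\<close> is minus the upper limit of -k, and all
    hypotheses of the propagation lemma survive the change of sign.\<close>
  have low: "\<forall>\<^sub>F x in at_top. - k x \<le> - ?L + e" if "e > 0" for e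
  proof -
    have nB: "\<bar>- k x\<bar> \<le> B" for x using kB by simp
    have nL: "\<bar>- k x - - k y\<bar> \<le> 2 * B * f 0 * \<bar>x - y\<bar>" for x y
      using kL[of x y] by (simp add: abs_minus_commute)
    have nk: "((\<lambda>u. - k u - convolution (\<lambda>x. - k x) u) \<longlongrightarrow> 0) at_top"
      using tendsto_minus[OF kk] by (simp add: convolution_def)
    obtain u M where u: "filterlim u at_top sequentially" "(\<lambda>n. - k (u n)) \<longlonglongrightarrow> M"
      "\<And>\<epsilon>. \<epsilon> > 0 \<Longrightarrow> \<forall>\<^sub>F x in at_top. - k x \<le> M + \<epsilon>"
      by (rule bounded_limsup_sequence[of "\<lambda>x. - k x" B, OF nB]) (rule that, assumption+)
    have nm: "(\<lambda>x. - k x) \<in> borel_measurable borel" by measurable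
    have "(\<lambda>n. m (u n - v)) \<longlonglongrightarrow> - M" if "v \<ge> 0" for v
      using conv[OF u(1) tendsto_minus[OF limsup_propagates[OF nm nB nL nk u(3,1,2) that], simplified]] by simp
    from lim[OF u(1) this] have "M = - ?L" by linarith
    with u(3)[OF that] show ?thesis by simp
  qed
  have "(k \<longlongrightarrow> ?L) at_top"
  proof (rule tendstoI)
    fix e :: real assume e: "e > 0"
    show "\<forall>\<^sub>F x in at_top. dist (k x) ?L < e"
      using up[OF half_gt_zero[OF e]] low[OF half_gt_zero[OF e]]
      by eventually_elim (use e in \<open>simp add: dist_real_def abs_less_iff\<close>)
  qed
  from tendsto_add[OF mk this] show ?thesis by simp
qed

theorem renewal_theorem:
  assumes [measurable]: "m \<in> borel_measurable borel" "z \<in> borel_measurable borel"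
    and m0: "\<And>x. 0 \<le> m x"
    and mneg: "\<And>x. x < 0 \<Longrightarrow> m x = 0"
    and loc: "\<And>U. \<exists>B. \<forall>x\<le>U. m x \<le> B"
    and z: "\<And>y. 0 \<le> z y" "\<And>y. z y \<le> z0"
    and zlim: "(z \<longlongrightarrow> 0) at_top"
    and zint: "(\<integral>\<^sup>+y. indicator {0..} y * ennreal (z y) \<partial>lborel) = ennreal w"
    and w: "0 \<le> w"
    and eq: "\<And>y. 0 \<le> y \<Longrightarrow>
      ennreal (m y) = ennreal (z y) + (\<integral>\<^sup>+s. ennreal (f s * m (y - s)) \<partial>lborel)"
  shows "\<exists>B. \<forall>x. m x \<le> B"
    and "(m \<longlongrightarrow> enn2real (ennreal w / (\<integral>\<^sup>+s. indicator {0..} s * ennreal (tail s) \<partial>lborel))) at_top"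
proof -
  have fin: "(\<integral>\<^sup>+y. indicator {0..u} y * ennreal (m y) \<partial>lborel) < \<infinity>" for u
  proof -
    obtain B where B: "\<forall>x\<le>u. m x \<le> B" using loc by blast
    have "(\<integral>\<^sup>+y. indicator {0..u} y * ennreal (m y) \<partial>lborel) \<le> (\<integral>\<^sup>+y. ennreal B * indicator {0..u} y \<partial>lborel)"
      using B by (intro nn_integral_mono) (auto intro!: ennreal_leI split: split_indicator)
    also have "\<dots> < \<infinity>"
      by (simp add: nn_integral_cmult_indicator emeasure_lborel_Icc_eq ennreal_mult_less_top)
    finally show ?thesis .
  qed
  have zi: "integrable lborel (\<lambda>y. indicator {0..} y * z y)"
    and zi': "(LINT y|lborel. indicator {0..} y * z y) = w"
  proof -
    have "has_bochner_integral lborel (\<lambda>y. indicator {0..} y * z y) w"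
    proof (rule has_bochner_integral_nn_integral)
      show "(\<integral>\<^sup>+y. ennreal (indicator {0..} y * z y) \<partial>lborel) = ennreal w"
        unfolding zint[symmetric] by (intro nn_integral_cong) (auto split: split_indicator)
    qed (use z w in auto)
    then show "integrable lborel (\<lambda>y. indicator {0..} y * z y)" "(LINT y|lborel. indicator {0..} y * z y) = w"
      by (auto simp: has_bochner_integral_iff)
  qed
  \<comment> \<open>By \<open>renewal_workload\<close> this is the workload at u; it increases to
    the full integral w of \<open>z\<close>.\<close>
  define W where "W u = (LINT y|lborel. indicator {0..u} y * z y)" for u
  have zu: "integrable lborel (\<lambda>y. indicator {0..u} y * z y)" for u
    by (rule Bochner_Integration.integrable_bound[OF zi]) (auto simp: z split: split_indicator)
  have W: "(\<integral>\<^sup>+s. indicator {0..} s * ennreal (tail s * m (u - s)) \<partial>lborel) = ennreal (W u)" for u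
  proof -
    have "(\<integral>\<^sup>+s. indicator {0..} s * ennreal (tail s * m (u - s)) \<partial>lborel) =
      (\<integral>\<^sup>+y. indicator {0..u} y * ennreal (z y) \<partial>lborel)"
      by (rule renewal_workload) (use m0 mneg eq fin in auto)
    also have "\<dots> = (\<integral>\<^sup>+y. ennreal (indicator {0..u} y * z y) \<partial>lborel)"
      by (intro nn_integral_cong) (auto split: split_indicator)
    also have "\<dots> = ennreal (W u)"
      unfolding W_def by (intro nn_integral_eq_integral zu) (auto simp: z)
    finally show ?thesis .
  qed
  have W0: "0 \<le> W u" for u unfolding W_def by (intro integral_nonneg_AE) (auto simp: z)
  have Ww: "W u \<le> w" for u
    unfolding W_def zi'[symmetric] by (intro integral_mono zu zi) (auto simp: z split: split_indicator)
  have Wlim: "(W \<longlongrightarrow> w) at_top"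
    unfolding W_def[abs_def] zi'[symmetric]
  proof (rule integral_dominated_convergence_at_top[where w="\<lambda>y. indicator {0..} y * z y"])
    show "AE y in lborel. ((\<lambda>u. indicator {0..u} y * z y) \<longlongrightarrow> indicator {0..} y * z y) at_top"
    proof (rule AE_I2)
      fix y
      have "\<forall>\<^sub>F u in at_top. indicator {0..u} y * z y = indicator {0..} y * z y"
        using eventually_ge_at_top[of y] by eventually_elim (auto split: split_indicator)
      then show "((\<lambda>u. indicator {0..u} y * z y) \<longlongrightarrow> indicator {0..} y * z y) at_top"
        by (rule tendsto_eventually)
    qed
  qed (use zi z in \<open>auto intro!: always_eventually AE_I2 split: split_indicator\<close>)
  show bdd: "\<exists>B. \<forall>x. m x \<le> B"
    by (rule renewal_bounded[where z=z and ?z0.0=z0 and w=w])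
      (use m0 mneg loc eq z w order.trans[OF z] W in \<open>auto intro!: ennreal_leI Ww\<close>)
  then obtain B where B: "\<And>x. m x \<le> B" by blast
  have Babs: "\<bar>m x\<bar> \<le> B" for x using m0 B by (simp add: abs_of_nonneg)
  have "m u = z u + convolution m u" if "0 \<le> u" for u
  proof -
    have "(\<integral>\<^sup>+s. ennreal (f s * m (u - s)) \<partial>lborel) = ennreal (convolution m u)"
      unfolding convolution_def using Babs
      by (intro nn_integral_eq_integral integrable_convolution) (auto simp: f_nonneg m0)
    moreover have "0 \<le> convolution m u"
      unfolding convolution_def by (intro integral_nonneg_AE) (auto simp: f_nonneg m0)
    ultimately show ?thesis
      using eq[OF that] z[of u] m0[of u] by (simp add: ennreal_plus[symmetric] del: ennreal_plus)
  qed
  then have "\<forall>\<^sub>F u in at_top. z u = m u - convolution m u"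
    by (intro eventually_mono[OF eventually_ge_at_top[of 0]]) auto
  then have "((\<lambda>u. m u - convolution m u) \<longlongrightarrow> 0) at_top"
    using zlim by (rule Lim_transform_eventually[rotated])
  then show "(m \<longlongrightarrow> enn2real (ennreal w / (\<integral>\<^sup>+s. indicator {0..} s * ennreal (tail s) \<partial>lborel))) at_top"
    by (intro renewal_limit[OF _ m0 B _ W W0 Wlim]) auto
qed

end

section \<open>Tails of finite measures on the half-line\<close>

lemma space_finite_measures: "M \<in> finite_measures \<Longrightarrow> space M = {0..}"
  by (auto simp: finite_measures_def space_restrict_space dest: sets_eq_imp_space_eq)

lemma sets_finite_measures: "M \<in> finite_measures \<Longrightarrow> A \<in> sets borel \<Longrightarrow> A \<subseteq> {0..} \<Longrightarrow> A \<in> sets M"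
  by (auto simp: finite_measures_def sets_restrict_space)

lemma borel_measurable_finite_measures:
  assumes "M \<in> finite_measures" "g \<in> borel_measurable borel"
  shows "g \<in> borel_measurable M"
proof -
  have "g \<in> borel_measurable Rplus_borel" using assms(2) by (rule measurable_restrict_space1)
  then show ?thesis
    using assms(1) by (subst measurable_cong_sets[of M Rplus_borel]) (auto simp: finite_measures_def)
qed

lemma integrable_bounded_continuous:
  assumes "M \<in> finite_measures" "g \<in> bounded_continuous"
  shows "integrable M g"
proof -
  interpret finite_measure M using assms by (simp add: finite_measures_def)
  obtain B where B: "\<And>x. x \<ge> 0 \<Longrightarrow> norm (g x) \<le> B"
    using assms(2) by (auto simp: bounded_continuous_def bounded_iff)
  have "g \<in> borel_measurable Rplus_borel"
    using assms(2) by (intro borel_measurable_continuous_on_restrict) (auto simp: bounded_continuous_def)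
  then have "g \<in> borel_measurable M"
    using assms(1) by (subst measurable_cong_sets[of M Rplus_borel]) (auto simp: finite_measures_def)
  moreover have "AE x in M. norm (g x) \<le> B"
    using B space_finite_measures[OF assms(1)] by (intro AE_I2) auto
  ultimately show ?thesis by (rule integrable_const_bound[rotated])
qed

lemma total_mass_eq: "M \<in> finite_measures \<Longrightarrow> total_mass M = measure M {0..}"
  by (simp add: total_mass_def pairing_def space_finite_measures)

lemma pairing_scale_measure:
  assumes "M \<in> finite_measures" "g \<in> bounded_continuous" "0 \<le> c"
  shows "pairing g (scale_measure (ennreal c) M) = c * pairing g M"
proof -
  have "scale_measure (ennreal c) M = density M (\<lambda>_. ennreal c)"
    by (rule measure_eqI) (auto simp: emeasure_density_const)
  then show ?thesis
    using integrable_bounded_continuous[OF assms(1,2)] assms(3)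
    by (simp add: pairing_def integral_density borel_measurable_integrable)
qed

text \<open>For x < 0 the set {x<..} is not measurable in the half-line and would get measure 0. The
  maximum with 0 keeps the function decreasing on the whole line.\<close>

definition ccdf :: "real measure \<Rightarrow> real \<Rightarrow> real" where
  "ccdf M x = measure M {max 0 x<..}"

lemma ccdf_antimono:
  assumes "M \<in> finite_measures" "x \<le> y"
  shows "ccdf M y \<le> ccdf M x"
proof -
  interpret finite_measure M using assms by (simp add: finite_measures_def)
  show ?thesis
    unfolding ccdf_def using assms
    by (intro finite_measure_mono sets_finite_measures[OF assms(1)]) auto
qed

lemma ccdf_nonneg: "0 \<le> ccdf M x"
  by (simp add: ccdf_def)

lemma ccdf_measurable[measurable]:
  assumes "M \<in> finite_measures"
  shows "ccdf M \<in> borel_measurable borel"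
proof -
  have "(\<lambda>x. - ccdf M x) \<in> borel_measurable borel"
    by (intro borel_measurable_mono monoI) (simp add: ccdf_antimono[OF assms])
  from borel_measurable_uminus[OF this] show ?thesis by simp
qed

lemma ccdf_at_top:
  assumes "M \<in> finite_measures"
  shows "(ccdf M \<longlongrightarrow> 0) at_top"
proof (rule tendsto_at_topI_sequentially)
  interpret finite_measure M using assms by (simp add: finite_measures_def)
  fix X :: "nat \<Rightarrow> real" assume X: "filterlim X at_top sequentially"
  have [measurable]: "(\<lambda>x. x) \<in> borel_measurable M"
    by (rule borel_measurable_finite_measures[OF assms]) simp
  have "(\<lambda>n. LINT x|M. indicator {X n<..} x) \<longlonglongrightarrow> (LINT x|M. (0::real))"
  proof (rule integral_dominated_convergence[where w="\<lambda>_. 1"])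
    show "AE x in M. (\<lambda>n. indicator {X n<..} x :: real) \<longlonglongrightarrow> 0"
    proof (rule AE_I2)
      fix x
      have "\<forall>\<^sub>F n in sequentially. indicator {X n<..} x = (0::real)"
        using filterlim_iff[THEN iffD1, OF X, rule_format, OF eventually_ge_at_top[of x]]
        by eventually_elim auto
      then show "(\<lambda>n. indicator {X n<..} x :: real) \<longlonglongrightarrow> 0" by (rule tendsto_eventually)
    qed
  qed auto
  moreover have "\<forall>\<^sub>F n in sequentially. (LINT x|M. indicator {X n<..} x) = ccdf M (X n)"
    using filterlim_iff[THEN iffD1, OF X, rule_format, OF eventually_ge_at_top[of 0]]
  proof eventually_elim
    case (elim n)
    then have "{X n<..} \<in> sets M" by (intro sets_finite_measures[OF assms]) auto
    then show ?case using elim by (simp add: ccdf_def)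
  qed
  ultimately show "(\<lambda>n. ccdf M (X n)) \<longlonglongrightarrow> 0"
    by (simp add: tendsto_cong)
qed

text \<open>Layer-cake formula: x is the length of {y. 0 <= y < x}, and Tonelli exchanges the
  integrals. An infinite first moment is covered.\<close>

lemma nn_integral_ccdf:
  assumes "M \<in> finite_measures"
  shows "(\<integral>\<^sup>+y. indicator {0..} y * ennreal (ccdf M y) \<partial>lborel) = first_moment M"
proof -
  interpret finite_measure M using assms by (simp add: finite_measures_def)
  interpret P: pair_sigma_finite lborel M by standard
  have [measurable]: "(\<lambda>x. x) \<in> borel_measurable M"
    by (rule borel_measurable_finite_measures[OF assms]) simp
  have "first_moment M = (\<integral>\<^sup>+x. \<integral>\<^sup>+y. indicator {0..} y * indicator {y<..} x \<partial>lborel \<partial>M)"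
    unfolding first_moment_def
  proof (intro nn_integral_cong)
    fix x assume "x \<in> space M"
    then have x: "0 \<le> x" using space_finite_measures[OF assms] by auto
    have "(\<integral>\<^sup>+y. indicator {0..} y * indicator {y<..} x \<partial>lborel) = (\<integral>\<^sup>+y. indicator {0..<x} y \<partial>lborel)"
      by (intro nn_integral_cong) (auto split: split_indicator)
    then show "ennreal x = (\<integral>\<^sup>+y. indicator {0..} y * indicator {y<..} x \<partial>lborel)" using x by simp
  qed
  also have "\<dots> = (\<integral>\<^sup>+y. \<integral>\<^sup>+x. indicator {0..} y * indicator {y<..} x \<partial>M \<partial>lborel)"
  proof (rule P.Fubini')
    have "(\<lambda>(y, x). indicator {0..} y * (if y < x then 1 else 0) :: ennreal) \<in> borel_measurable (lborel \<Otimes>\<^sub>M M)"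
      by measurable
    then show "(\<lambda>(y, x). indicator {0..} y * indicator {y<..} x :: ennreal) \<in> borel_measurable (lborel \<Otimes>\<^sub>M M)"
      by (simp add: indicator_def)
  qed
  also have "\<dots> = (\<integral>\<^sup>+y. indicator {0..} y * ennreal (ccdf M y) \<partial>lborel)"
  proof (intro nn_integral_cong)
    fix y :: real
    show "(\<integral>\<^sup>+x. indicator {0..} y * indicator {y<..} x \<partial>M) = indicator {0..} y * ennreal (ccdf M y)"
    proof (cases "0 \<le> y")
      case True
      then have "{y<..} \<in> sets M" by (intro sets_finite_measures[OF assms]) auto
      then show ?thesis using True by (simp add: ccdf_def emeasure_eq_measure)
    qed simp
  qed
  finally show ?thesis ..
qed

lemma first_moment_pos:
  assumes fm: "M \<in> finite_measures" and "0 < measure M {0<..}"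
  shows "0 < first_moment M"
proof -
  have "first_moment M \<noteq> 0"
  proof
    assume "first_moment M = 0"
    then have "AE x in M. ennreal x = 0"
      unfolding first_moment_def using borel_measurable_finite_measures[OF fm, of ennreal]
      by (subst (asm) nn_integral_0_iff_AE) auto
    then have "AE x in M. x \<notin> {0<..}" by eventually_elim (auto simp: ennreal_eq_0_iff)
    moreover have "{0<..} \<in> sets M" by (rule sets_finite_measures[OF fm]) auto
    ultimately have "measure M {0<..} = 0"
      by (intro measure_eq_0_null_sets) (simp add: AE_iff_null_sets)
    then show False using assms(2) by simp
  qed
  then show ?thesis by (simp add: zero_less_iff_neq_zero)
qed

text \<open>Dividing by the total masses gives probability measures with converging distribution
  functions, to which the real-line theory of weak convergence applies. Multiplying by the masses
  returns to the original pairings.\<close>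

lemma pairing_tendsto:
  assumes M: "\<And>n. M n \<in> finite_measures" and N: "N \<in> finite_measures" "prob_space N"
    and c: "0 \<le> c" and mass: "(\<lambda>n. total_mass (M n)) \<longlonglongrightarrow> c"
    and pos: "\<And>n. 0 < total_mass (M n)"
    and tail: "\<And>x. 0 \<le> x \<Longrightarrow> (\<lambda>n. ccdf (M n) x) \<longlonglongrightarrow> c * ccdf N x"
    and g: "g \<in> bounded_continuous"
  shows "(\<lambda>n. pairing g (M n)) \<longlonglongrightarrow> c * pairing g N"
proof -
  obtain B where B: "\<And>x. x \<ge> 0 \<Longrightarrow> \<bar>g x\<bar> \<le> B"
    using g by (auto simp: bounded_continuous_def bounded_iff)
  \<comment> \<open>The real-line theory asks for an integrand continuous everywhere, so
    \<open>g\<close> is continued by its value at 0.\<close>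
  define h where "h x = g (max 0 x)" for x
  have hcont: "continuous_on UNIV h"
  proof -
    have "continuous_on {0..} g" using g by (simp add: bounded_continuous_def)
    moreover have "continuous_on UNIV (\<lambda>x::real. max 0 x)" by (intro continuous_intros)
    moreover have "(\<lambda>x::real. max 0 x) ` UNIV \<subseteq> {0..}" by auto
    ultimately show ?thesis unfolding h_def by (rule continuous_on_compose2)
  qed
  then have hm[measurable]: "h \<in> borel_measurable borel" by (rule borel_measurable_continuous_onI)
  \<comment> \<open>Pushing forward along the identity moves the normalised measure from the
    half-line to the Borel sets of the real line.\<close>
  define P where "P K = distr (density K (\<lambda>_. ennreal (1 / total_mass K))) borel (\<lambda>x. x)" for K :: "real measure"
  have idm: "(\<lambda>x. x) \<in> measurable (density K (\<lambda>_. ennreal (1 / total_mass K))) borel"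
    if "K \<in> finite_measures" for K
    using borel_measurable_finite_measures[OF that, of "\<lambda>x. x"] by simp
  have emP: "emeasure (P K) A = ennreal (measure K (A \<inter> {0..}) / total_mass K)"
    if K: "K \<in> finite_measures" and p: "0 < total_mass K" and A: "A \<in> sets borel" for K A
  proof -
    interpret finite_measure K using K by (simp add: finite_measures_def)
    have "A \<inter> {0..} \<in> sets K" using A by (intro sets_finite_measures[OF K]) auto
    then show ?thesis
      using A p K unfolding P_def
      by (subst emeasure_distr[OF idm[OF K]])
        (auto simp: space_finite_measures vimage_def emeasure_density_const Int_def emeasure_eq_measure
          ennreal_mult[symmetric] conj_commute)
  qed
  have rd: "real_distribution (P K)" if K: "K \<in> finite_measures" and p: "0 < total_mass K" for K
  proof (intro real_distribution.intro real_distribution_axioms.intro prob_spaceI)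
    show "emeasure (P K) (space (P K)) = 1"
      using p by (subst emP[OF K p]) (auto simp: P_def total_mass_eq[OF K])
  qed (simp add: P_def)
  have cdfP: "cdf (P K) x = (if 0 \<le> x then 1 - ccdf K x / total_mass K else 0)"
    if K: "K \<in> finite_measures" and p: "0 < total_mass K" for K x
  proof -
    interpret finite_measure K using K by (simp add: finite_measures_def)
    have "cdf (P K) x = measure K ({..x} \<inter> {0..}) / total_mass K"
      unfolding cdf_def measure_def[of "P K"] using p by (subst emP[OF K p]) auto
    moreover have "measure K ({..x} \<inter> {0..}) = total_mass K - ccdf K x" if x: "0 \<le> x"
    proof -
      have "measure K ({0..} - {x<..}) = measure K {0..} - measure K {x<..}"
        using x by (intro finite_measure_Diff sets_finite_measures[OF K]) auto
      moreover have "{0..} - {x<..} = {..x} \<inter> {0..}" by auto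
      ultimately show ?thesis using x by (simp add: total_mass_eq[OF K] ccdf_def)
    qed
    moreover have "{..x} \<inter> {0..} = {}" if "x < 0" using that by auto
    ultimately show ?thesis using p by (auto simp: field_simps not_le)
  qed
  have intP: "(LINT x|P K. h x) = pairing g K / total_mass K"
    if K: "K \<in> finite_measures" and p: "0 < total_mass K" for K
  proof -
    have "(LINT x|P K. h x) = (LINT x|density K (\<lambda>_. ennreal (1 / total_mass K)). h x)"
      unfolding P_def by (rule integral_distr[OF idm[OF K]]) simp
    also have "\<dots> = (LINT x|K. (1 / total_mass K) *\<^sub>R h x)"
      using p borel_measurable_finite_measures[OF K hm] by (intro integral_density) auto
    also have "\<dots> = (LINT x|K. g x / total_mass K)"
      using space_finite_measures[OF K]
      by (intro Bochner_Integration.integral_cong) (auto simp: h_def)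
    finally show ?thesis by (simp add: pairing_def)
  qed
  have N1: "total_mass N = 1"
    using prob_space.prob_space[OF N(2)] by (simp add: total_mass_eq[OF N(1)] space_finite_measures[OF N(1)])
  show ?thesis
  proof (cases "c = 0")
    \<comment> \<open>If the masses vanish in the limit, the normalised tails are not controlled,
      but a bounded \<open>g\<close> is then directly dominated by B times the mass. This case
      arises when the excess lifetime has infinite mean.\<close>
    case True
    have "\<bar>pairing g (M n)\<bar> \<le> B * total_mass (M n)" for n
    proof -
      interpret finite_measure "M n" using M by (simp add: finite_measures_def)
      have "\<bar>pairing g (M n)\<bar> \<le> (LINT x|M n. \<bar>g x\<bar>)"
        unfolding pairing_def by (rule integral_abs_bound)
      also have "\<dots> \<le> (LINT x|M n. B * 1)"
        using integrable_bounded_continuous[OF M g] B space_finite_measures[OF M]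
        by (intro integral_mono) auto
      finally show ?thesis unfolding total_mass_def pairing_def by (simp add: mult.commute)
    qed
    then show ?thesis
      using Lim_null_comparison[of "\<lambda>n. pairing g (M n)" "\<lambda>n. B * total_mass (M n)" sequentially]
        tendsto_mult[OF tendsto_const[of B] mass] True by simp
  next
    case False
    then have c0: "c > 0" using c by simp
    have "weak_conv_m (\<lambda>n. P (M n)) (P N)"
      unfolding weak_conv_m_def weak_conv_def
    proof (intro allI impI)
      fix x
      show "(\<lambda>n. cdf (P (M n)) x) \<longlonglongrightarrow> cdf (P N) x"
      proof (cases "0 \<le> x")
        case True
        have "(\<lambda>n. 1 - ccdf (M n) x / total_mass (M n)) \<longlonglongrightarrow> 1 - c * ccdf N x / c"
          using c0 by (intro tendsto_intros tail True mass) auto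
        then show ?thesis using True c0 by (simp add: cdfP M N N1 pos)
      qed (simp add: cdfP M N N1 pos)
    qed
    then have "(\<lambda>n. LINT x|P (M n). h x) \<longlonglongrightarrow> (LINT x|P N. h x)"
      using rd[OF M pos] rd[OF N(1)] N1 B hcont
      by (intro weak_conv_imp_integral_bdd_continuous_conv[where B=B])
        (auto simp: h_def continuous_on_eq_continuous_at)
    then have "(\<lambda>n. pairing g (M n) / total_mass (M n)) \<longlonglongrightarrow> pairing g N"
      by (simp add: intP M N pos N1)
    from tendsto_mult[OF mass this] pos show ?thesis
      by (simp add: less_imp_neq[symmetric] order_less_imp_not_eq2)
  qed
qed

section \<open>Critical data and the excess lifetime distribution\<close>

lemma critical_data_finite_measures: "critical_data \<alpha> \<nu> \<Longrightarrow> \<nu> \<in> finite_measures"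
  by (auto simp: critical_data_def finite_measures_def prob_space.finite_measure)

lemma critical_data_pos:
  assumes "critical_data \<alpha> \<nu>"
  shows "0 < \<alpha>" "ennreal \<alpha> * first_moment \<nu> = 1" "ccdf \<nu> 0 = 1"
proof -
  interpret prob_space \<nu> using assms by (simp add: critical_data_def)
  note fm = critical_data_finite_measures[OF assms]
  have z: "measure \<nu> {0} = 0" and fin: "first_moment \<nu> < \<infinity>" and \<alpha>: "\<alpha> = 1 / enn2real (first_moment \<nu>)"
    using assms by (auto simp: critical_data_def)
  have "measure \<nu> ({0..} - {0}) = measure \<nu> {0..} - measure \<nu> {0}"
    by (intro finite_measure_Diff sets_finite_measures[OF fm]) auto
  moreover have "{0..} - {0} = {0::real<..}" by auto
  ultimately show 1: "ccdf \<nu> 0 = 1"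
    using z prob_space by (simp add: ccdf_def space_finite_measures[OF fm])
  have "0 < first_moment \<nu>"
    using 1 by (intro first_moment_pos fm) (simp add: ccdf_def)
  then obtain r where r: "first_moment \<nu> = ennreal r" "r > 0"
    using fin by (cases "first_moment \<nu>") (auto simp: less_le)
  then show "0 < \<alpha>" "ennreal \<alpha> * first_moment \<nu> = 1"
    by (auto simp: \<alpha> ennreal_mult[symmetric])
qed

text \<open>The integral equals 1 by the layer-cake formula, because \<alpha> is the reciprocal of
  the mean of \<nu>.\<close>

lemma critical_data_renewal_density:
  assumes "critical_data \<alpha> \<nu>"
  shows "renewal_density (\<lambda>x. indicator {0..} x * (\<alpha> * ccdf \<nu> x))"
proof
  note fm = critical_data_finite_measures[OF assms] and pos = critical_data_pos[OF assms]
  note [measurable] = ccdf_measurable[OF fm]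
  show "(\<lambda>x. indicator {0..} x * (\<alpha> * ccdf \<nu> x)) \<in> borel_measurable borel" by measurable
  show "has_bochner_integral lborel (\<lambda>x. indicator {0..} x * (\<alpha> * ccdf \<nu> x)) 1"
  proof (rule has_bochner_integral_nn_integral)
    have "(\<integral>\<^sup>+x. ennreal (indicator {0..} x * (\<alpha> * ccdf \<nu> x)) \<partial>lborel) =
      (\<integral>\<^sup>+x. ennreal \<alpha> * (indicator {0..} x * ennreal (ccdf \<nu> x)) \<partial>lborel)"
      using pos by (intro nn_integral_cong) (auto simp: ennreal_mult ccdf_nonneg split: split_indicator)
    also have "\<dots> = 1" by (subst nn_integral_cmult) (auto simp: nn_integral_ccdf[OF fm] pos)
    finally show "(\<integral>\<^sup>+x. ennreal (indicator {0..} x * (\<alpha> * ccdf \<nu> x)) \<partial>lborel) = ennreal 1" by simp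
  qed (use pos in \<open>auto simp: ccdf_nonneg\<close>)
qed (use critical_data_pos[OF assms] ccdf_antimono[OF critical_data_finite_measures[OF assms]]
    in \<open>auto simp: ccdf_nonneg\<close>)

lemma excess_measure_props:
  assumes "critical_data \<alpha> \<nu>"
  defines "f \<equiv> \<lambda>x. indicator {0..} x * (\<alpha> * ccdf \<nu> x)"
  shows "excess_measure \<alpha> \<nu> \<in> finite_measures" "prob_space (excess_measure \<alpha> \<nu>)"
    and "\<And>x. ccdf (excess_measure \<alpha> \<nu>) x = renewal_density.tail f (max 0 x)"
proof -
  interpret prob_space \<nu> using assms by (simp add: critical_data_def)
  note fm = critical_data_finite_measures[OF assms(1)] and pos = critical_data_pos[OF assms(1)]
  interpret f: renewal_density f
    unfolding f_def by (rule critical_data_renewal_density[OF assms(1)])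
  \<comment> \<open>The two densities agree only on the half-line: for x < 0 the left side is
    \<alpha> and the right side is 0. That suffices, since the excess measure lives on
    {0..}.\<close>
  have f_eq: "\<alpha> * (1 - dist_fun \<nu> x) = f x" if x: "0 \<le> x" for x
  proof -
    have "measure \<nu> ({0..} - {x<..}) = measure \<nu> {0..} - measure \<nu> {x<..}"
      using x by (intro finite_measure_Diff sets_finite_measures[OF fm]) auto
    moreover have "{0..} - {x<..} = {0..x}" by auto
    ultimately show ?thesis
      using x prob_space by (simp add: f_def dist_fun_def ccdf_def space_finite_measures[OF fm])
  qed
  have dm: "(\<lambda>x. ennreal (\<alpha> * (1 - dist_fun \<nu> x))) \<in> borel_measurable (restrict_space lborel {0..})"
    by (subst measurable_cong[where g="\<lambda>x. ennreal (f x)"])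
      (auto simp: space_restrict_space f_eq intro!: measurable_restrict_space1)
  have em: "emeasure (excess_measure \<alpha> \<nu>) A = (\<integral>\<^sup>+x. indicator A x * ennreal (f x) \<partial>lborel)"
    if A: "A \<in> sets borel" "A \<subseteq> {0..}" for A
  proof -
    have "A \<in> sets (restrict_space lborel {0..})" using A by (auto simp: sets_restrict_space)
    then have "emeasure (excess_measure \<alpha> \<nu>) A =
      (\<integral>\<^sup>+x. ennreal (\<alpha> * (1 - dist_fun \<nu> x)) * indicator A x \<partial>restrict_space lborel {0..})"
      unfolding excess_measure_def by (intro emeasure_density dm)
    also have "\<dots> = (\<integral>\<^sup>+x. indicator A x * ennreal (f x) \<partial>restrict_space lborel {0..})"
      by (intro nn_integral_cong) (auto simp: space_restrict_space f_eq mult.commute)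
    also have "\<dots> = (\<integral>\<^sup>+x. indicator A x * ennreal (f x) * indicator {0..} x \<partial>lborel)"
      by (subst nn_integral_restrict_space) auto
    also have "\<dots> = (\<integral>\<^sup>+x. indicator A x * ennreal (f x) \<partial>lborel)"
      using A by (intro nn_integral_cong) (auto split: split_indicator)
    finally show ?thesis .
  qed
  have sets: "sets (excess_measure \<alpha> \<nu>) = sets Rplus_borel"
    by (simp add: excess_measure_def cong: sets_restrict_space_cong)
  then have space: "space (excess_measure \<alpha> \<nu>) = {0..}"
    by (auto dest: sets_eq_imp_space_eq simp: space_restrict_space)
  show prob: "prob_space (excess_measure \<alpha> \<nu>)"
  proof
    have "emeasure (excess_measure \<alpha> \<nu>) {0..} = (\<integral>\<^sup>+x. ennreal (f x) \<partial>lborel)"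
      by (subst em) (auto simp: f_def intro!: nn_integral_cong split: split_indicator)
    also have "\<dots> = 1"
      using nn_integral_eq_integral[OF f.f_integrable] f.f_nonneg by (simp add: f.f_integral_eq)
    finally show "emeasure (excess_measure \<alpha> \<nu>) (space (excess_measure \<alpha> \<nu>)) = 1"
      by (simp add: space)
  qed
  then show "excess_measure \<alpha> \<nu> \<in> finite_measures"
    using sets by (simp add: finite_measures_def prob_space.finite_measure)
  fix x :: real
  have "{max 0 x<..} \<subseteq> {0..}" by auto
  then show "ccdf (excess_measure \<alpha> \<nu>) x = f.tail (max 0 x)"
    unfolding ccdf_def measure_def by (subst em) (auto simp: f.nn_integral_tail f.tail_nonneg)
qed

section \<open>Fluid model solutions do not die out\<close>

lemma pairing_cong: "M \<in> finite_measures \<Longrightarrow> (\<And>x. 0 \<le> x \<Longrightarrow> g x = h x) \<Longrightarrow> pairing g M = pairing h M"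
  unfolding pairing_def
  by (intro Bochner_Integration.integral_cong) (auto simp: space_finite_measures)

lemma pairing_mono:
  assumes "M \<in> finite_measures" "g \<in> bounded_continuous" "h \<in> bounded_continuous"
    and "\<And>x. 0 \<le> x \<Longrightarrow> g x \<le> h x"
  shows "pairing g M \<le> pairing h M"
  unfolding pairing_def using assms integrable_bounded_continuous[OF assms(1)]
  by (intro integral_mono) (auto simp: space_finite_measures)

lemma const_bounded_continuous: "(\<lambda>_. c) \<in> bounded_continuous"
  by (auto simp: bounded_continuous_def image_constant_conv)

lemma pairing_const: "pairing (\<lambda>_. c) M = c * total_mass M"
  by (simp add: pairing_def total_mass_def mult.commute)

lemma pairing_bound:
  assumes "M \<in> finite_measures" "g \<in> bounded_continuous" "\<And>x. 0 \<le> x \<Longrightarrow> \<bar>g x\<bar> \<le> B"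
  shows "\<bar>pairing g M\<bar> \<le> B * total_mass M"
proof -
  have "- B \<le> g x" "g x \<le> B" if "0 \<le> x" for x
    using assms(3)[OF that] by (auto simp: abs_le_iff)
  then show ?thesis
    using pairing_mono[OF assms(1,2) const_bounded_continuous[of B]]
      pairing_mono[OF assms(1) const_bounded_continuous[of "-B"] assms(2)]
    by (auto simp: pairing_const abs_le_iff)
qed

lemma bounded_continuousI:
  "continuous_on {0..} g \<Longrightarrow> (\<And>x. 0 \<le> x \<Longrightarrow> \<bar>g x\<bar> \<le> B) \<Longrightarrow> g \<in> bounded_continuous"
  by (auto simp: bounded_continuous_def bounded_iff)

lemma bounded_continuous_diff:
  assumes "g \<in> bounded_continuous" "h \<in> bounded_continuous"
  shows "(\<lambda>x. g x - h x) \<in> bounded_continuous"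
proof -
  obtain B C where "\<forall>x\<ge>0. \<bar>g x\<bar> \<le> B" "\<forall>x\<ge>0. \<bar>h x\<bar> \<le> C"
    using assms by (auto simp: bounded_continuous_def bounded_iff)
  then have "\<bar>g x - h x\<bar> \<le> B + C" if "0 \<le> x" for x
    using that abs_triangle_ineq4[of "g x" "h x"] by fastforce
  then show ?thesis
    using assms by (intro bounded_continuousI[where B="B + C"])
      (auto simp: bounded_continuous_def intro: continuous_on_diff)
qed

lemma bounded_continuous_cmult:
  assumes "g \<in> bounded_continuous"
  shows "(\<lambda>x. c * g x) \<in> bounded_continuous"
proof -
  obtain B where "\<forall>x\<ge>0. \<bar>g x\<bar> \<le> B"
    using assms by (auto simp: bounded_continuous_def bounded_iff)
  then show ?thesis
    using assms by (intro bounded_continuousI[where B="\<bar>c\<bar> * B"])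
      (auto simp: bounded_continuous_def abs_mult intro: continuous_on_mult_left mult_left_mono)
qed

lemma pairing_diff:
  "M \<in> finite_measures \<Longrightarrow> g \<in> bounded_continuous \<Longrightarrow> h \<in> bounded_continuous \<Longrightarrow>
    pairing (\<lambda>x. g x - h x) M = pairing g M - pairing h M"
  unfolding pairing_def
  by (intro Bochner_Integration.integral_diff integrable_bounded_continuous)

lemma pairing_cmult: "pairing (\<lambda>x. c * g x) M = c * pairing g M"
  by (simp add: pairing_def)

lemma continuous_on_pairing:
  assumes "continuous_map (top_of_set {0..}) weak_topology \<mu>" "g \<in> bounded_continuous"
  shows "continuous_on {0..} (\<lambda>t. pairing g (\<mu> t))"
proof -
  have "continuous_map weak_topology euclidean (pairing g)"
    unfolding continuous_map_def
  proof (intro conjI allI impI)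
    fix U :: "real set" assume "openin euclidean U"
    then show "openin weak_topology {\<zeta> \<in> topspace weak_topology. pairing g \<zeta> \<in> U}"
      unfolding topspace_weak_topology unfolding weak_topology_def using assms(2)
      by (intro topology_generated_by_Basis) auto
  qed simp
  from continuous_map_compose[OF assms(1) this] show ?thesis
    by (simp add: comp_def)
qed

lemma test_functionsI:
  assumes d: "\<And>x. 0 \<le> x \<Longrightarrow> (g has_real_derivative g' x) (at x within {0..})"
    and c: "continuous_on {0..} g'"
    and b: "\<And>x. 0 \<le> x \<Longrightarrow> \<bar>g x\<bar> \<le> B" "\<And>x. 0 \<le> x \<Longrightarrow> \<bar>g' x\<bar> \<le> B'"
    and 0: "g 0 = 0" "g' 0 = 0"
  shows "g \<in> test_functions" "\<And>x. 0 \<le> x \<Longrightarrow> deriv_plus g x = g' x"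
    and "g \<in> bounded_continuous" "g' \<in> bounded_continuous"
proof -
  show dp: "deriv_plus g x = g' x" if "0 \<le> x" for x
  proof -
    \<comment> \<open>Derivatives within {0..} are unique only at its limit points. A connected set
      that is not a singleton consists of limit points, so the endpoint 0 is included.\<close>
    have "\<nexists>y. {0::real..} = {y}"
      by (metis atLeast_iff not_one_le_zero order_refl singletonD zero_le_one)
    then have "x islimpt {0..}"
      using that connected_imp_perfect[of "{0..}" x] by auto
    then show ?thesis
      unfolding deriv_plus_def using d[OF that]
      by (intro vector_derivative_within)
        (auto simp: trivial_limit_within has_real_derivative_iff_has_vector_derivative)
  qed
  have gc: "continuous_on {0..} g"
    using d by (intro DERIV_continuous_on) auto
  have "g differentiable_on {0..}"
    using d by (auto simp: differentiable_on_def real_differentiable_def)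
  moreover have "continuous_on {0..} (deriv_plus g)"
    using c by (rule continuous_on_eq) (simp add: dp)
  ultimately show "g \<in> test_functions"
    using b 0 by (auto simp: test_functions_def C1_bounded_def bounded_iff dp)
  show "g \<in> bounded_continuous" "g' \<in> bounded_continuous"
    by (rule bounded_continuousI[OF gc b(1)] bounded_continuousI[OF c b(2)], simp)+
qed

lemma ccdf_0:
  assumes M: "M \<in> finite_measures" and "pairing (indicator {0}) M = 0"
  shows "ccdf M 0 = total_mass M"
proof -
  interpret finite_measure M using M by (simp add: finite_measures_def)
  have s: "{0} \<in> sets M" by (rule sets_finite_measures[OF M]) auto
  have "measure M ({0..} - {0}) = measure M {0..} - measure M {0}"
    by (intro finite_measure_Diff sets_finite_measures[OF M]) auto
  moreover have "{0..} - {0} = {0::real<..}" by auto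
  ultimately show ?thesis
    using assms(2) s by (simp add: pairing_def ccdf_def total_mass_eq[OF M])
qed

text \<open>The identity is unbounded, hence no test function. It is approached from below, with
  itself as the integrable majorant.\<close>

lemma pairing_first_moment:
  assumes M: "M \<in> finite_measures" and fin: "first_moment M < \<infinity>"
    and g: "\<And>n x. 0 \<le> x \<Longrightarrow> 0 \<le> g n x" "\<And>n x. 0 \<le> x \<Longrightarrow> g n x \<le> x"
    and bc: "\<And>n. g n \<in> bounded_continuous"
    and lim: "\<And>x. 0 \<le> x \<Longrightarrow> (\<lambda>n. g n x) \<longlonglongrightarrow> x"
  shows "(\<lambda>n. pairing (g n) M) \<longlonglongrightarrow> enn2real (first_moment M)"
proof -
  have [measurable]: "(\<lambda>x. x) \<in> borel_measurable M"
    by (rule borel_measurable_finite_measures[OF M]) simp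
  have "has_bochner_integral M (\<lambda>x. x) (enn2real (first_moment M))"
    using fin space_finite_measures[OF M]
    by (intro has_bochner_integral_nn_integral) (auto simp: first_moment_def ennreal_enn2real_if less_top)
  then have int: "integrable M (\<lambda>x. x)" "(LINT x|M. x) = enn2real (first_moment M)"
    by (auto simp: has_bochner_integral_iff)
  show ?thesis
    unfolding pairing_def int(2)[symmetric]
  proof (rule integral_dominated_convergence[where w="\<lambda>x. x"])
    show "g n \<in> borel_measurable M" for n
      using integrable_bounded_continuous[OF M bc] by (rule borel_measurable_integrable)
    show "AE x in M. (\<lambda>n. g n x) \<longlonglongrightarrow> x"
      using lim space_finite_measures[OF M] by (intro AE_I2) simp
    show "AE x in M. norm (g n x) \<le> x" for n
      using g[of _ n] space_finite_measures[OF M] by (intro AE_I2) simp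
  qed (use int in simp_all)
qed

text \<open>The approximations \<open>x\<^sup>2 / (e + x + e * x\<^sup>2)\<close> of the identity are admissible test functions
  with slope at most \<open>1\<close>. Hence the workload is drained at rate at most \<open>1\<close>, which is the rate at which
  it arrives, and it never reaches \<open>0\<close>.\<close>

definition id_approx :: "real \<Rightarrow> real \<Rightarrow> real" where
  "id_approx e x = x\<^sup>2 / (e + x + e * x\<^sup>2)"

definition id_approx' :: "real \<Rightarrow> real \<Rightarrow> real" where
  "id_approx' e x = (2 * e * x + x\<^sup>2) / (e + x + e * x\<^sup>2)\<^sup>2"

text \<open>In the denominator, the summand e makes value and slope vanish at 0, and e * x^2 makes
  the function bounded by 1 / e.\<close>

lemma id_approx:
  assumes e: "0 < e"
  shows "id_approx e \<in> test_functions" "id_approx e \<in> bounded_continuous"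
    "\<And>x. 0 \<le> x \<Longrightarrow> deriv_plus (id_approx e) x = id_approx' e x"
    "id_approx' e \<in> bounded_continuous"
    "\<And>x. 0 \<le> x \<Longrightarrow> 0 \<le> id_approx e x" "\<And>x. 0 \<le> x \<Longrightarrow> id_approx e x \<le> x"
    "\<And>x. 0 \<le> x \<Longrightarrow> id_approx' e x \<le> 1"
proof -
  have den: "0 < e + x + e * x\<^sup>2" if "0 \<le> x" for x :: real
    using that e by (simp add: add_pos_nonneg)
  have d: "(id_approx e has_real_derivative id_approx' e x) (at x within {0..})" if x: "0 \<le> x" for x
    unfolding id_approx_def[abs_def] id_approx'_def using den[OF x]
    by (auto intro!: derivative_eq_intros simp: field_simps power2_eq_square)
  have c: "continuous_on {0..} (id_approx' e)"
    unfolding id_approx'_def[abs_def] using den by (intro continuous_intros) force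
  have b: "\<bar>id_approx e x\<bar> \<le> 1 / e" if x: "0 \<le> x" for x
    using den[OF x] e x by (simp add: id_approx_def field_simps)
  show 1: "id_approx' e x \<le> 1" if x: "0 \<le> x" for x
  proof -
    \<comment> \<open>The numerator of the slope is (e + x)^2 without e^2, and e + x is at most the
      unsquared denominator.\<close>
    have "2 * e * x + x\<^sup>2 \<le> (e + x)\<^sup>2" by (simp add: power2_sum)
    also have "\<dots> \<le> (e + x + e * x\<^sup>2)\<^sup>2" using x e by (intro power_mono) auto
    finally show ?thesis using den[OF x] by (simp add: id_approx'_def)
  qed
  have "0 \<le> id_approx' e x" if x: "0 \<le> x" for x
    using den[OF x] e x by (simp add: id_approx'_def)
  with 1 have b': "\<bar>id_approx' e x\<bar> \<le> 1" if x: "0 \<le> x" for x using x by simp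
  have 0: "id_approx e 0 = 0" "id_approx' e 0 = 0" by (simp_all add: id_approx_def id_approx'_def)
  note t = test_functionsI[of "id_approx e" "id_approx' e", OF d c b b' 0]
  show "id_approx e \<in> test_functions" "id_approx e \<in> bounded_continuous"
    "id_approx' e \<in> bounded_continuous" using t by auto
  show "deriv_plus (id_approx e) x = id_approx' e x" if "0 \<le> x" for x using t(2) that by auto
  show "0 \<le> id_approx e x" if x: "0 \<le> x" for x
    using den[OF x] by (simp add: id_approx_def)
  show "id_approx e x \<le> x" if x: "0 \<le> x" for x
    using den[OF x] e x by (simp add: id_approx_def field_simps power2_eq_square)
qed

lemma id_approx_tendsto: "0 \<le> x \<Longrightarrow> (\<lambda>n. id_approx (1 / Suc n) x) \<longlonglongrightarrow> x"
proof (cases "x = 0")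
  case False
  assume "0 \<le> x"
  then have "(\<lambda>n. x\<^sup>2 / (1 / Suc n + x + 1 / Suc n * x\<^sup>2)) \<longlonglongrightarrow> x\<^sup>2 / (0 + x + 0 * x\<^sup>2)"
    using False by (intro tendsto_intros LIMSEQ_inverse_real_of_nat[unfolded inverse_eq_divide]) auto
  then show ?thesis using False by (simp add: id_approx_def power2_eq_square)
qed (simp add: id_approx_def)

text \<open>Positive initial mass is required because the service clock divides by the mass; the
  zero initial measure is treated in the final theorem.\<close>

locale fluid_solution =
  fixes \<alpha> :: real and \<nu> :: "real measure" and \<mu> :: "real \<Rightarrow> real measure"
  assumes crit: "critical_data \<alpha> \<nu>" and sol: "fluid_model_solution \<alpha> \<nu> \<mu>"
    and mass0: "0 < total_mass (\<mu> 0)" and moment0: "first_moment (\<mu> 0) < \<infinity>"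
begin

lemma \<nu>_finite: "\<nu> \<in> finite_measures" by (rule critical_data_finite_measures[OF crit])

lemma \<mu>_continuous: "continuous_map (top_of_set {0..}) weak_topology \<mu>"
  using sol by (simp add: fluid_model_solution_def)

lemma \<mu>_finite: "0 \<le> t \<Longrightarrow> \<mu> t \<in> finite_measures"
  using continuous_map_funspace[OF \<mu>_continuous] by (auto simp: topspace_weak_topology)

lemma pairing_cont: "g \<in> bounded_continuous \<Longrightarrow> continuous_on {0..} (\<lambda>t. pairing g (\<mu> t))"
  by (rule continuous_on_pairing[OF \<mu>_continuous])

lemma mass_cont: "continuous_on {0..} (\<lambda>t. total_mass (\<mu> t))"
  unfolding total_mass_def by (rule pairing_cont[OF const_bounded_continuous])

lemma mass_nonneg: "0 \<le> total_mass M"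
  by (simp add: total_mass_def pairing_def)

lemma no_mass_at_0: "0 \<le> t \<Longrightarrow> pairing (indicator {0}) (\<mu> t) = 0"
  using sol by (simp add: fluid_model_solution_def)

lemma moment0_pos: "0 < first_moment (\<mu> 0)"
  using ccdf_0[OF \<mu>_finite no_mass_at_0, of 0] mass0
  by (intro first_moment_pos \<mu>_finite) (auto simp: ccdf_def)

text \<open>Up to the first zero \<tau> of the mass, at most \<tau> units of work are drained, and
  \<alpha> * \<tau> times the mean of \<nu>, again \<tau>, arrive. The positive initial workload
  would have to survive at \<tau>, where the measure has mass 0.\<close>

lemma never_extinct:
  assumes t: "0 \<le> t" shows "0 < total_mass (\<mu> t)"
proof (rule ccontr)
  assume "\<not> ?thesis"
  then have qt: "total_mass (\<mu> t) = 0" using mass_nonneg[of "\<mu> t"] by simp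
  define Z where "Z = {s \<in> {0..}. total_mass (\<mu> s) = 0}"
  \<comment> \<open>Closedness makes the infimum of the zeros a zero itself.\<close>
  have cl: "closed Z"
    unfolding Z_def by (rule continuous_closed_preimage_constant[OF mass_cont]) simp
  have ne: "Z \<noteq> {}" and bdd: "bdd_below Z" using t qt by (auto simp: Z_def intro: bdd_belowI)
  define \<tau> where "\<tau> = Inf Z"
  have \<tau>Z: "\<tau> \<in> Z" unfolding \<tau>_def by (rule closed_contains_Inf[OF ne bdd cl])
  then have \<tau>0: "0 \<le> \<tau>" and q\<tau>: "total_mass (\<mu> \<tau>) = 0" by (auto simp: Z_def)
  have \<tau>pos: "0 < \<tau>" using \<tau>0 q\<tau> mass0 by (cases "\<tau> = 0") auto
  have lower: "\<tau> \<le> s" if "s \<in> Z" for s unfolding \<tau>_def by (rule cInf_lower[OF that bdd])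
  have ext: "ereal s < extinction_time \<mu>" if s: "s < \<tau>" for s
  proof -
    have "ereal \<tau> \<le> extinction_time \<mu>"
      unfolding extinction_time_def by (intro INF_greatest) (auto simp: Z_def intro!: lower)
    then show ?thesis using s by (metis ereal_less(2) less_ereal.simps(1) less_le_trans)
  qed
  have pos: "0 < total_mass (\<mu> s)" if "0 \<le> s" "s < \<tau>" for s
    using lower[of s] that mass_nonneg[of "\<mu> s"] by (auto simp: Z_def less_le)
  note \<alpha> = critical_data_pos[OF crit]
  \<comment> \<open>The workload balance for the truncated identity; the truncation is removed only
    after reaching \<tau>.\<close>
  have key: "pairing g (\<mu> 0) - \<tau> + \<alpha> * \<tau> * pairing g \<nu> \<le> 0" if g: "g = id_approx e" and e: "0 < e" for g e
  proof -
    note ga = id_approx[OF e, folded g]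
    have ge: "pairing g (\<mu> 0) - s + \<alpha> * s * pairing g \<nu> \<le> pairing g (\<mu> s)" if s: "0 \<le> s" "s < \<tau>" for s
    proof -
      have eq: "pairing (deriv_plus g) (\<mu> r) = pairing (id_approx' e) (\<mu> r)" if "0 \<le> r" for r
        by (rule pairing_cong[OF \<mu>_finite[OF that]]) (rule ga(3))
      have "pairing (deriv_plus g) (\<mu> r) / total_mass (\<mu> r) \<le> 1" if r: "0 \<le> r" "r \<le> s" for r
        using pairing_mono[OF \<mu>_finite[OF r(1)] ga(4) const_bounded_continuous[of 1] ga(7)] pos[of r] r s
        by (simp add: eq pairing_const)
      moreover have "set_integrable lborel {0..s} (\<lambda>r. pairing (deriv_plus g) (\<mu> r) / total_mass (\<mu> r))"
      proof (rule borel_integrable_atLeastAtMost')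
        have "continuous_on {0..s} (\<lambda>r. pairing (id_approx' e) (\<mu> r) / total_mass (\<mu> r))"
          using pos s by (intro continuous_on_divide continuous_on_subset[OF pairing_cont[OF ga(4)]]
              continuous_on_subset[OF mass_cont]) force+
        then show "continuous_on {0..s} (\<lambda>r. pairing (deriv_plus g) (\<mu> r) / total_mass (\<mu> r))"
          by (rule continuous_on_eq) (simp add: eq)
      qed
      ultimately have "(LBINT r:{0..s}. pairing (deriv_plus g) (\<mu> r) / total_mass (\<mu> r)) \<le> (LBINT r:{0..s}. 1)"
        using s by (intro set_integral_mono) (auto simp: set_integrable_def intro!: integrable_real_indicator simp: emeasure_lborel_Icc_eq)
      also have "\<dots> = s" using s by (simp add: set_lebesgue_integral_def)
      finally show ?thesis
        using sol ga(1) s ext[OF s(2)] by (simp add: fluid_model_solution_def)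
    qed
    have ev: "\<forall>\<^sub>F s in at_left \<tau>. 0 \<le> s \<and> s < \<tau>"
      using eventually_at_left_real[OF \<tau>pos] by eventually_elim auto
    \<comment> \<open>The fluid equation is available only strictly before extinction, so \<tau> is
      approached from the left by weak continuity.\<close>
    have "((\<lambda>s. pairing g (\<mu> s)) \<longlongrightarrow> pairing g (\<mu> \<tau>)) (at_left \<tau>)"
    proof -
      have "((\<lambda>s. pairing g (\<mu> s)) \<longlongrightarrow> pairing g (\<mu> \<tau>)) (at \<tau> within {0..})"
        using pairing_cont[OF ga(2)] \<tau>0 by (auto simp: continuous_on_def)
      then have "((\<lambda>s. pairing g (\<mu> s)) \<longlongrightarrow> pairing g (\<mu> \<tau>)) (at \<tau> within {0..<\<tau>})"
        by (rule tendsto_within_subset) auto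
      moreover have "at \<tau> within {0..<\<tau>} = at_left \<tau>"
        using \<tau>pos by (intro at_within_nhd[of _ "{0<..}"]) auto
      ultimately show ?thesis by simp
    qed
    moreover have "((\<lambda>s. pairing g (\<mu> 0) - s + \<alpha> * s * pairing g \<nu>) \<longlongrightarrow> pairing g (\<mu> 0) - \<tau> + \<alpha> * \<tau> * pairing g \<nu>) (at_left \<tau>)"
      by (intro tendsto_intros)
    ultimately have "pairing g (\<mu> 0) - \<tau> + \<alpha> * \<tau> * pairing g \<nu> \<le> pairing g (\<mu> \<tau>)"
      by (rule tendsto_le[rotated]) (use ev ge in \<open>auto elim!: eventually_mono\<close>)
    moreover have "\<bar>pairing g (\<mu> \<tau>)\<bar> \<le> 0"
    proof -
      obtain B where "\<forall>x\<ge>0. \<bar>g x\<bar> \<le> B" using ga(2) by (auto simp: bounded_continuous_def bounded_iff)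
      then show ?thesis using pairing_bound[OF \<mu>_finite[OF \<tau>0] ga(2), of B] q\<tau> by simp
    qed
    ultimately show ?thesis by linarith
  qed
  have "(\<lambda>n. pairing (id_approx (1 / Suc n)) (\<mu> 0) - \<tau> + \<alpha> * \<tau> * pairing (id_approx (1 / Suc n)) \<nu>)
    \<longlonglongrightarrow> enn2real (first_moment (\<mu> 0)) - \<tau> + \<alpha> * \<tau> * enn2real (first_moment \<nu>)"
    using crit moment0
    by (intro tendsto_intros pairing_first_moment \<nu>_finite \<mu>_finite id_approx id_approx_tendsto)
      (auto simp: critical_data_def)
  moreover have "\<forall>n. pairing (id_approx (1 / Suc n)) (\<mu> 0) - \<tau> + \<alpha> * \<tau> * pairing (id_approx (1 / Suc n)) \<nu> \<le> 0"
    by (intro allI key) auto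
  ultimately have "enn2real (first_moment (\<mu> 0)) - \<tau> + \<alpha> * \<tau> * enn2real (first_moment \<nu>) \<le> 0"
    by (intro LIMSEQ_le_const2) auto
  moreover have critical_rate: "\<alpha> * enn2real (first_moment \<nu>) = 1"
    using crit \<alpha>(1) by (auto simp: critical_data_def)
  moreover have "0 < enn2real (first_moment (\<mu> 0))"
    using moment0_pos moment0 by (simp add: enn2real_positive_iff)
  moreover have "\<alpha> * \<tau> * enn2real (first_moment \<nu>) = \<tau>"
    using critical_rate by algebra
  ultimately show False by linarith
qed

lemma fluid_equation:
  assumes "g \<in> test_functions" "0 \<le> t"
  shows "pairing g (\<mu> t) = pairing g (\<mu> 0)
    - (LBINT s:{0..t}. pairing (deriv_plus g) (\<mu> s) / total_mass (\<mu> s)) + \<alpha> * t * pairing g \<nu>"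
proof -
  have Z: "{s. 0 \<le> s \<and> total_mass (\<mu> s) = 0} = {}"
    by (auto dest: never_extinct)
  have "extinction_time \<mu> = \<infinity>"
    by (simp only: extinction_time_def Z image_empty Inf_empty top_ereal_def)
  then have "ereal t < extinction_time \<mu>" by simp
  moreover have "\<forall>g\<in>test_functions. \<forall>t\<ge>0. ereal t < extinction_time \<mu> \<longrightarrow>
      pairing g (\<mu> t) = pairing g (\<mu> 0)
        - (LBINT s:{0..t}. pairing (deriv_plus g) (\<mu> s) / total_mass (\<mu> s)) + \<alpha> * t * pairing g \<nu>"
    using sol unfolding fluid_model_solution_def by (elim conjE)
  ultimately show ?thesis using assms by blast
qed

end

section \<open>The transport equation along the service clock\<close>

text \<open>A smoothed indicator of (0, infinity). The square makes value and slope vanish on the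
  negative axis and keeps the derivative Lipschitz across 0.\<close>

definition soft_step :: "real \<Rightarrow> real" where
  "soft_step y = (max 0 y)\<^sup>2 / (1 + (max 0 y)\<^sup>2)"

definition soft_step' :: "real \<Rightarrow> real" where
  "soft_step' y = 2 * max 0 y / (1 + (max 0 y)\<^sup>2)\<^sup>2"

lemma one_plus_square_pos: "0 < 1 + (x::real)\<^sup>2"
  by (simp add: add_pos_nonneg)

lemma soft_step_deriv: "(soft_step has_real_derivative soft_step' y) (at y)"
proof -
  consider "y > 0" | "y < 0" | "y = 0" by linarith
  then show ?thesis
  proof cases
    case 1
    have "((\<lambda>y. y\<^sup>2 / (1 + y\<^sup>2)) has_real_derivative soft_step' y) (at y)"
      unfolding soft_step'_def using 1 one_plus_square_pos[of y]
      by (auto intro!: derivative_eq_intros simp: field_simps power2_eq_square)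
    then show ?thesis
      by (rule has_field_derivative_transform_within_open[where S="{0<..}"])
        (use 1 in \<open>auto simp: soft_step_def\<close>)
  next
    case 2
    have "((\<lambda>y. 0) has_real_derivative soft_step' y) (at y)"
      using 2 by (simp add: soft_step'_def)
    then show ?thesis
      by (rule has_field_derivative_transform_within_open[where S="{..<0}"])
        (use 2 in \<open>auto simp: soft_step_def\<close>)
  next
    case 3
    \<comment> \<open>The function is at most h^2 near the junction, so the difference quotient at 0
      is at most |h|.\<close>
    have le: "\<bar>soft_step h / h\<bar> \<le> \<bar>h\<bar>" for h
    proof -
      have "soft_step h \<le> (max 0 h)\<^sup>2"
        unfolding soft_step_def using one_plus_square_pos[of "max 0 h"]
        by (simp add: divide_le_eq mult_left_mono algebra_simps)
      also have "\<dots> \<le> \<bar>h\<bar> * \<bar>h\<bar>"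
        by (auto simp: max_def power2_eq_square)
      finally have "soft_step h \<le> \<bar>h\<bar> * \<bar>h\<bar>" .
      moreover have "0 \<le> soft_step h" by (simp add: soft_step_def)
      ultimately show ?thesis by (cases "h = 0") (auto simp: abs_divide divide_le_eq)
    qed
    have "(\<lambda>h. soft_step h / h) \<midarrow>0\<rightarrow> 0"
      by (rule Lim_null_comparison[of _ "\<lambda>h. \<bar>h\<bar>"]) (use le in \<open>auto intro!: tendsto_eq_intros\<close>)
    then show ?thesis
      using 3 by (simp add: DERIV_def soft_step'_def soft_step_def)
  qed
qed

lemma soft_step_bounds: "0 \<le> soft_step y" "soft_step y \<le> 1" "\<bar>soft_step y\<bar> \<le> 1"
  using one_plus_square_pos[of "max 0 y"] by (auto simp: soft_step_def divide_le_eq)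

text \<open>The derivative is a smooth function composed with the 1-Lipschitz map y -> max 0 y. It
  therefore suffices to bound the derivative of the smooth function by 2.\<close>

lemma soft_step'_lipschitz: "\<bar>soft_step' x - soft_step' y\<bar> \<le> 2 * \<bar>x - y\<bar>"
proof -
  define k where "k r = 2 * r / (1 + r\<^sup>2)\<^sup>2" for r :: real
  define k' where "k' r = 2 * (1 - 3 * r\<^sup>2) / (1 + r\<^sup>2) ^ 3" for r :: real
  have d: "(k has_field_derivative k' r) (at r within UNIV)" for r
  proof -
    have "(k has_field_derivative (2 * (1 + r\<^sup>2)\<^sup>2 - 2 * r * (2 * (1 + r\<^sup>2) * (2 * r))) / ((1 + r\<^sup>2)\<^sup>2 * (1 + r\<^sup>2)\<^sup>2)) (at r)"
      unfolding k_def[abs_def] using one_plus_square_pos[of r]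
      by (auto intro!: derivative_eq_intros simp: power2_eq_square)
    also have "(2 * (1 + r\<^sup>2)\<^sup>2 - 2 * r * (2 * (1 + r\<^sup>2) * (2 * r))) / ((1 + r\<^sup>2)\<^sup>2 * (1 + r\<^sup>2)\<^sup>2) = k' r"
    proof -
      define w where "w = 1 + r\<^sup>2"
      have "2 * w\<^sup>2 - 2 * r * (2 * w * (2 * r)) = 2 * (1 - 3 * r\<^sup>2) * w"
        by (simp add: w_def power2_eq_square algebra_simps)
      moreover have "w \<noteq> 0" using one_plus_square_pos[of r] by (simp add: w_def)
      ultimately show ?thesis
        unfolding k'_def w_def[symmetric] by (simp add: power2_eq_square power3_eq_cube field_simps)
    qed
    finally show ?thesis .
  qed
  have b: "norm (k' r) \<le> 2" for r
  proof -
    have "\<bar>2 * (1 - 3 * r\<^sup>2)\<bar> \<le> 2 * (1 + 3 * r\<^sup>2)" by (simp add: abs_le_iff)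
    also have "\<dots> \<le> 2 * (1 + r\<^sup>2) ^ 3"
      using Bernoulli_inequality[of "r\<^sup>2" 3] order.trans[OF _ zero_le_power2[of r], of "-1"] by simp
    finally show ?thesis
      using one_plus_square_pos[of r] by (simp add: k'_def abs_divide divide_le_eq)
  qed
  have "norm (k (max 0 x) - k (max 0 y)) \<le> 2 * norm (max 0 x - max 0 y)"
    by (rule field_differentiable_bound[OF convex_UNIV d b]) auto
  also have "\<dots> \<le> 2 * \<bar>x - y\<bar>" by (auto simp: max_def)
  finally show ?thesis by (simp add: k_def soft_step'_def)
qed

lemma soft_step'_bound: "\<bar>soft_step' y\<bar> \<le> 1"
proof -
  define p where "p = max 0 y"
  have "2 * p \<le> 1 + p\<^sup>2" using sum_squares_bound[of 1 p] by (simp add: power2_eq_square)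
  also have "\<dots> * 1 \<le> (1 + p\<^sup>2) * (1 + p\<^sup>2)" by (intro mult_left_mono) auto
  finally have "2 * p \<le> (1 + p\<^sup>2)\<^sup>2" by (simp add: power2_eq_square)
  then show ?thesis
    using one_plus_square_pos[of p] by (simp add: soft_step'_def p_def[symmetric]) (simp add: p_def)
qed

text \<open>The value at 0 stays 0, so the limit is the indicator of the open half-line, matching
  the strict inequality in \<open>ccdf\<close>.\<close>

lemma soft_step_tendsto:
  "(\<lambda>n. soft_step (real (Suc n) * y)) \<longlonglongrightarrow> indicator {0<..} y"
proof (cases "0 < y")
  case True
  have "(\<lambda>n. 1 / (1 / (real (Suc n) * y)\<^sup>2 + 1)) \<longlonglongrightarrow> 1 / ((0 / y) ^ 2 + 1)"
  proof (intro tendsto_intros)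
    have "(\<lambda>n. (1 / real (Suc n) / y)\<^sup>2) \<longlonglongrightarrow> (0 / y)\<^sup>2"
      using True by (intro tendsto_intros LIMSEQ_inverse_real_of_nat[unfolded inverse_eq_divide]) auto
    then show "(\<lambda>n. 1 / (real (Suc n) * y)\<^sup>2) \<longlonglongrightarrow> (0 / y)\<^sup>2"
      by (simp add: power_divide power_mult_distrib)
  qed simp
  moreover have "1 / (1 / (real (Suc n) * y)\<^sup>2 + 1) = soft_step (real (Suc n) * y)" for n
  proof -
    have "1 / (1 / w + 1) = w / (1 + w)" if "0 < w" for w :: real
      using that by (simp add: field_simps)
    from this[of "(real (Suc n) * y)\<^sup>2"] show ?thesis
      using True by (simp add: soft_step_def)
  qed
  ultimately show ?thesis using True by simp
next
  case False
  then have "soft_step (real (Suc n) * y) = 0" for n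
    by (simp add: soft_step_def max_def mult_le_0_iff zero_le_mult_iff)
  then show ?thesis using False by simp
qed

lemma shift_bounded_continuous:
  assumes "continuous_on UNIV g" "\<And>x. \<bar>g x\<bar> \<le> B"
  shows "(\<lambda>x. g (x - c)) \<in> bounded_continuous"
  using assms
  by (intro bounded_continuousI[where B=B] continuous_on_compose2[OF assms(1)] continuous_intros) auto

lemma pairing_soft_step_tendsto:
  assumes M: "M \<in> finite_measures" and x: "0 \<le> x"
  shows "(\<lambda>n. pairing (\<lambda>y. soft_step (real (Suc n) * (y - x))) M) \<longlonglongrightarrow> ccdf M x"
proof -
  interpret finite_measure M using M by (simp add: finite_measures_def)
  have cont: "continuous_on UNIV soft_step"
    using soft_step_deriv by (intro DERIV_continuous_on) (auto intro: has_field_derivative_at_within)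
  have bc: "(\<lambda>y. soft_step (real (Suc n) * (y - x))) \<in> bounded_continuous" for n
    by (rule bounded_continuousI[where B=1])
      (auto simp: soft_step_bounds intro!: continuous_on_compose2[OF cont] continuous_intros)
  have s: "{x<..} \<in> sets M" using x by (intro sets_finite_measures[OF M]) auto
  have "(\<lambda>n. LINT y|M. soft_step (real (Suc n) * (y - x))) \<longlonglongrightarrow> (LINT y|M. indicator {x<..} y)"
  proof (rule integral_dominated_convergence[where w="\<lambda>_. 1"])
    show "(\<lambda>y. soft_step (real (Suc n) * (y - x))) \<in> borel_measurable M" for n
      using integrable_bounded_continuous[OF M bc] by (rule borel_measurable_integrable)
    show "AE y in M. (\<lambda>n. soft_step (real (Suc n) * (y - x))) \<longlonglongrightarrow> indicator {x<..} y"
    proof (rule AE_I2)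
      fix y
      have "indicator {0<..} (y - x) = (indicator {x<..} y :: real)" by (auto split: split_indicator)
      then show "(\<lambda>n. soft_step (real (Suc n) * (y - x))) \<longlonglongrightarrow> indicator {x<..} y"
        using soft_step_tendsto[of "y - x"] by simp
    qed
  qed (use s soft_step_bounds in auto)
  then show ?thesis using s x by (simp add: pairing_def ccdf_def)
qed

text \<open>A first-order expansion whose error is uniform in x. Uniformity matters because the
  error is later integrated against a measure that moves as well.\<close>

lemma lipschitz_derivative_remainder:
  fixes g g' :: "real \<Rightarrow> real"
  assumes d: "\<And>x. (g has_real_derivative g' x) (at x)"
    and lip: "\<And>x y. \<bar>g' x - g' y\<bar> \<le> L * \<bar>x - y\<bar>"
  shows "\<bar>g y - g x - g' x * (y - x)\<bar> \<le> L * (y - x)\<^sup>2"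
proof -
  have L: "0 \<le> L" using lip[of 1 0] by simp
  have "\<exists>z. \<bar>z - x\<bar> \<le> \<bar>y - x\<bar> \<and> g y - g x = g' z * (y - x)"
  proof -
    consider "x < y" | "y < x" | "x = y" by linarith
    then show ?thesis
    proof cases
      case 1
      obtain z where "x < z" "z < y" "g y - g x = (y - x) * g' z"
        using MVT2[OF 1, of g g'] d by auto
      then show ?thesis by (intro exI[of _ z]) (auto simp: mult.commute)
    next
      case 2
      obtain z where "y < z" "z < x" "g x - g y = (x - y) * g' z"
        using MVT2[OF 2, of g g'] d by auto
      then show ?thesis by (intro exI[of _ z]) (auto simp: algebra_simps)
    qed auto
  qed
  then obtain z where z: "\<bar>z - x\<bar> \<le> \<bar>y - x\<bar>" "g y - g x = g' z * (y - x)" by blast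
  have "\<bar>g y - g x - g' x * (y - x)\<bar> = \<bar>g' z - g' x\<bar> * \<bar>y - x\<bar>"
    unfolding z(2) by (simp add: abs_mult[symmetric] algebra_simps)
  also have "\<dots> \<le> (L * \<bar>y - x\<bar>) * \<bar>y - x\<bar>"
    using lip[of z x] mult_left_mono[OF z(1) L] by (intro mult_right_mono) auto
  finally show ?thesis by (simp add: power2_eq_square)
qed

section \<open>The service clock and the tail equation\<close>

context fluid_solution begin

text \<open>Freezing the mass at its initial value for negative times makes it continuous and
  positive on the whole line, so the clock has two-sided derivatives everywhere.\<close>

definition mass :: "real \<Rightarrow> real" where "mass t = total_mass (\<mu> (max 0 t))"

lemma mass_pos: "0 < mass t"
  by (simp add: mass_def never_extinct)

lemma mass_continuous: "continuous_on UNIV mass"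
proof -
  have "continuous_on UNIV (\<lambda>x::real. max 0 x)" by (intro continuous_intros)
  moreover have "(\<lambda>x::real. max 0 x) ` UNIV \<subseteq> {0..}" by auto
  ultimately show ?thesis
    unfolding mass_def[abs_def] by (rule continuous_on_compose2[OF mass_cont])
qed

text \<open>The service received up to time \<open>t\<close> by a job that is present all the time.\<close>

definition clock :: "real \<Rightarrow> real" where
  "clock = (SOME S. S 0 = 0 \<and> (\<forall>t. (S has_real_derivative 1 / mass t) (at t)))"

text \<open>The chosen function exists: the continuous function 1 / \<open>mass\<close> has an
  antiderivative on the whole line, which is then shifted to vanish at 0.\<close>

lemma clock: "clock 0 = 0" "(clock has_real_derivative 1 / mass t) (at t)"
proof -
  have "isCont (\<lambda>t. 1 / mass t) t" for t
    using mass_continuous mass_pos[of t]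
    by (intro continuous_intros) (auto simp: continuous_on_eq_continuous_at)
  then obtain F where F: "\<And>t. (F has_real_derivative 1 / mass t) (at t)"
    using einterval_antiderivative[of "-\<infinity>" "\<infinity>" "\<lambda>t. 1 / mass t"]
    by (auto simp: has_real_derivative_iff_has_vector_derivative)
  have "\<exists>S. S 0 = 0 \<and> (\<forall>t. (S has_real_derivative 1 / mass t) (at t))"
    by (rule exI[of _ "\<lambda>t. F t - F 0"]) (auto intro!: derivative_eq_intros F)
  from someI_ex[OF this] show "clock 0 = 0" "(clock has_real_derivative 1 / mass t) (at t)"
    by (auto simp: clock_def)
qed

lemma clock_strict_mono: "s < t \<Longrightarrow> clock s < clock t"
  by (rule DERIV_pos_imp_increasing) (use clock(2) mass_pos in \<open>auto intro!: exI\<close>)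

lemma clock_mono: "s \<le> t \<Longrightarrow> clock s \<le> clock t"
  using clock_strict_mono[of s t] by (cases "s = t") auto

lemma clock_continuous: "continuous_on A clock"
  using clock(2) by (intro DERIV_continuous_on) (auto intro: has_field_derivative_at_within)

text \<open>Along \<open>s \<mapsto> pairing (g (\<cdot> - (clock t - clock s))) (\<mu> s)\<close> the drift of the moving test
  function cancels the drift of the solution, and only the arrivals remain.\<close>

lemma transport_derivative:
  fixes g g' :: "real \<Rightarrow> real"
  assumes d: "\<And>x. (g has_real_derivative g' x) (at x)"
    and neg: "\<And>x. x \<le> 0 \<Longrightarrow> g x = 0" "\<And>x. x \<le> 0 \<Longrightarrow> g' x = 0"
    and b: "\<And>x. \<bar>g x\<bar> \<le> B" "\<And>x. \<bar>g' x\<bar> \<le> B'"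
    and lip: "\<And>x y. \<bar>g' x - g' y\<bar> \<le> L * \<bar>x - y\<bar>"
    and s: "0 \<le> s" "s \<le> t"
  shows "((\<lambda>r. pairing (\<lambda>x. g (x - (clock t - clock r))) (\<mu> r)) has_real_derivative
    \<alpha> * pairing (\<lambda>x. g (x - (clock t - clock s))) \<nu>) (at s within {0..t})"
proof -
  define c where "c r = clock t - clock r" for r
  define h where "h x = g (x - c s)" for x
  define h' where "h' x = g' (x - c s)" for x
  have L: "0 \<le> L" using lip[of 1 0] by simp
  \<comment> \<open>The shift is to the right, so the shifted function still has value and slope 0
    at the origin and remains an admissible test function.\<close>
  have cs: "0 \<le> c s" using clock_mono[OF s(2)] by (simp add: c_def)
  have gc: "continuous_on UNIV g"
    using d by (intro DERIV_continuous_on) (auto intro: has_field_derivative_at_within)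
  have "L-lipschitz_on UNIV g'"
    using lip L by (intro lipschitz_onI) (auto simp: dist_real_def)
  then have g'c: "continuous_on UNIV g'" by (rule lipschitz_on_continuous_on)
  have bc: "(\<lambda>x. g (x - a)) \<in> bounded_continuous" "(\<lambda>x. g' (x - a)) \<in> bounded_continuous" for a
    using shift_bounded_continuous[OF gc b(1)] shift_bounded_continuous[OF g'c b(2)] by auto
  have hd: "(h has_real_derivative h' x) (at x within {0..})" if "0 \<le> x" for x
  proof (rule has_field_derivative_at_within)
    have "((\<lambda>x. x - c s) has_real_derivative 1) (at x)" by (auto intro!: derivative_eq_intros)
    from DERIV_chain2[OF d this] show "(h has_real_derivative h' x) (at x)"
      by (simp add: h_def[abs_def] h'_def)
  qed
  have h'c: "continuous_on {0..} h'"
    using bc(2) by (simp add: h'_def[abs_def] bounded_continuous_def)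
  have h0: "h 0 = 0" "h' 0 = 0" using neg cs by (auto simp: h_def h'_def)
  note ht = test_functionsI[of h h' B B', OF hd h'c _ _ h0]
  have htest: "h \<in> test_functions" and hdp: "\<And>x. 0 \<le> x \<Longrightarrow> deriv_plus h x = h' x"
    and hbc: "h \<in> bounded_continuous" "h' \<in> bounded_continuous"
    using ht b by (auto simp: h_def h'_def)
  define E where "E r = pairing h' (\<mu> r)" for r
  have Ec: "continuous_on {0..t} E"
    unfolding E_def[abs_def] by (rule continuous_on_subset[OF pairing_cont[OF hbc(2)]]) auto
  have mc: "continuous_on {0..t} mass" by (rule continuous_on_subset[OF mass_continuous]) auto
  \<comment> \<open>First half of the product rule: the test function is frozen at time s and only
    the measure moves.\<close>
  have A: "((\<lambda>r. pairing h (\<mu> r)) has_real_derivative - (E s / mass s) + \<alpha> * pairing h \<nu>) (at s within {0..t})"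
  proof -
    have pc: "continuous_on {0..t} (\<lambda>r. E r / mass r)"
      using mass_pos by (intro continuous_on_divide Ec mc) (metis less_irrefl)
    have eq: "pairing h (\<mu> r) = pairing h (\<mu> 0) - integral {0..r} (\<lambda>r. E r / mass r) + \<alpha> * r * pairing h \<nu>"
      if r: "0 \<le> r" "r \<le> t" for r
    proof -
      have "(LBINT s:{0..r}. pairing (deriv_plus h) (\<mu> s) / total_mass (\<mu> s)) = (LBINT s:{0..r}. E s / mass s)"
        using pairing_cong[OF \<mu>_finite hdp]
        by (intro set_lebesgue_integral_cong) (auto simp: E_def mass_def)
      also have "\<dots> = integral {0..r} (\<lambda>r. E r / mass r)"
        using r by (intro set_borel_integral_eq_integral borel_integrable_atLeastAtMost'
            continuous_on_subset[OF pc]) auto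
      finally show ?thesis using fluid_equation[OF htest r(1)] by simp
    qed
    have "((\<lambda>r. pairing h (\<mu> 0) - integral {0..r} (\<lambda>r. E r / mass r) + \<alpha> * r * pairing h \<nu>)
        has_real_derivative - (E s / mass s) + \<alpha> * pairing h \<nu>) (at s within {0..t})"
      using s by (auto intro!: derivative_eq_intros integral_has_real_derivative[OF pc])
    then show ?thesis
      by (rule has_field_derivative_transform_within[where d=1]) (use s in \<open>auto intro!: eq[symmetric]\<close>)
  qed
  \<comment> \<open>Second half: the effect of moving the test function from its position at time s,
    evaluated at the current measure.\<close>
  define D where "D r = pairing (\<lambda>x. g (x - c r) - g (x - c s)) (\<mu> r)" for r
  \<comment> \<open>The linear part uses E r, at the same measure as D r, so that the remainder is a
    single pairing with a small function. Continuity of \<open>E\<close> replaces E r by E s in the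
    limit.\<close>
  define R where "R r = D r - (c s - c r) * E r" for r
  define Q where "Q r = (clock r - clock s) / (r - s)" for r
  have Q: "(Q \<longlongrightarrow> 1 / mass s) (at s within {0..t})"
    using has_field_derivative_at_within[OF clock(2)[of s], of "{0..t}"]
    unfolding has_field_derivative_iff Q_def .
  have Elim: "(E \<longlongrightarrow> E s) (at s within {0..t})"
    using Ec s by (auto simp: continuous_on_def)
  have mlim: "(mass \<longlongrightarrow> mass s) (at s within {0..t})"
    using mc s by (auto simp: continuous_on_def)
  have clim: "(clock \<longlongrightarrow> clock s) (at s within {0..t})"
    using clock_continuous[of "{0..t}"] s by (auto simp: continuous_on_def)
  have R: "\<bar>R r\<bar> \<le> L * (clock r - clock s)\<^sup>2 * mass r" if r: "0 \<le> r" for r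
  proof -
    have cc: "c s - c r = clock r - clock s" by (simp add: c_def)
    have bcR: "(\<lambda>x. (g (x - c r) - g (x - c s)) - (c s - c r) * h' x) \<in> bounded_continuous"
      by (intro bounded_continuous_diff bounded_continuous_cmult bc hbc)
    have "R r = pairing (\<lambda>x. (g (x - c r) - g (x - c s)) - (c s - c r) * h' x) (\<mu> r)"
      unfolding R_def D_def E_def
      by (subst pairing_diff[OF \<mu>_finite[OF r]])
        (auto simp: pairing_cmult intro!: bounded_continuous_diff bounded_continuous_cmult bc hbc)
    also have "\<bar>\<dots>\<bar> \<le> L * (clock r - clock s)\<^sup>2 * total_mass (\<mu> r)"
    proof (rule pairing_bound[OF \<mu>_finite[OF r] bcR])
      fix x
      have "(x - c r) - (x - c s) = clock r - clock s" by (simp add: c_def)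
      then show "\<bar>(g (x - c r) - g (x - c s)) - (c s - c r) * h' x\<bar> \<le> L * (clock r - clock s)\<^sup>2"
        using lipschitz_derivative_remainder[OF d lip, of "x - c r" "x - c s"]
        by (simp add: h'_def cc mult.commute)
    qed
    finally show ?thesis using r by (simp add: mass_def)
  qed
  have Rlim: "((\<lambda>r. R r / (r - s)) \<longlongrightarrow> 0) (at s within {0..t})"
  proof (rule Lim_null_comparison)
    show "\<forall>\<^sub>F r in at s within {0..t}. norm (R r / (r - s)) \<le> L * \<bar>Q r\<bar> * \<bar>clock r - clock s\<bar> * mass r"
      unfolding eventually_at_filter
    proof (rule always_eventually, intro allI impI)
      fix r assume r: "r \<noteq> s" "r \<in> {0..t}"
      have "norm (R r / (r - s)) = \<bar>R r\<bar> / \<bar>r - s\<bar>" by simp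
      also have "\<dots> \<le> (L * (clock r - clock s)\<^sup>2 * mass r) / \<bar>r - s\<bar>"
        using R[of r] r by (intro divide_right_mono) auto
      also have "\<dots> = L * \<bar>Q r\<bar> * \<bar>clock r - clock s\<bar> * mass r"
        by (simp add: Q_def abs_divide power2_eq_square abs_mult[symmetric])
      finally show "norm (R r / (r - s)) \<le> L * \<bar>Q r\<bar> * \<bar>clock r - clock s\<bar> * mass r" .
    qed
    have "((\<lambda>r. L * \<bar>Q r\<bar> * \<bar>clock r - clock s\<bar> * mass r) \<longlongrightarrow> L * \<bar>1 / mass s\<bar> * \<bar>clock s - clock s\<bar> * mass s) (at s within {0..t})"
      by (intro tendsto_intros Q clim mlim)
    then show "((\<lambda>r. L * \<bar>Q r\<bar> * \<bar>clock r - clock s\<bar> * mass r) \<longlongrightarrow> 0) (at s within {0..t})" by simp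
  qed
  have "(D has_real_derivative E s / mass s) (at s within {0..t})"
    unfolding has_field_derivative_iff
  proof -
    have D0: "D s = 0" by (simp add: D_def pairing_def)
    \<comment> \<open>The limit E s / mass s is exactly the drift that appears with negative sign in
      \<open>A\<close>.\<close>
    have "((\<lambda>r. Q r * E r + R r / (r - s)) \<longlongrightarrow> 1 / mass s * E s + 0) (at s within {0..t})"
      by (intro tendsto_intros Q Elim Rlim)
    moreover have "Q r * E r + R r / (r - s) = (D r - D s) / (r - s)" for r
      by (simp add: Q_def R_def D0 c_def add_divide_distrib[symmetric])
    ultimately show "((\<lambda>r. (D r - D s) / (r - s)) \<longlongrightarrow> E s / mass s) (at s within {0..t})" by simp
  qed
  from DERIV_add[OF A this]
  have deriv: "((\<lambda>r. pairing h (\<mu> r) + D r) has_real_derivative \<alpha> * pairing h \<nu>) (at s within {0..t})"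
    by simp
  have eq: "pairing h (\<mu> r) + D r = pairing (\<lambda>x. g (x - (clock t - clock r))) (\<mu> r)" if "0 \<le> r" for r
    unfolding D_def h_def
    by (subst pairing_diff[OF \<mu>_finite[OF that] bc(1) bc(1)]) (simp add: c_def)
  have h_eq: "h = (\<lambda>x. g (x - (clock t - clock s)))"
    by (simp add: h_def[abs_def] c_def)
  show ?thesis
    unfolding h_eq[symmetric]
    by (rule has_field_derivative_transform_within[OF deriv, of 1]) (use s in \<open>auto intro!: eq\<close>)
qed


lemma arrivals_continuous:
  assumes g: "continuous_on UNIV g" "\<And>x. \<bar>g x\<bar> \<le> B"
  shows "continuous_on A (\<lambda>s. pairing (\<lambda>x. g (x - (clock t - clock s))) \<nu>)"
proof -
  interpret prob_space \<nu> using crit by (simp add: critical_data_def)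
  note bc = shift_bounded_continuous[OF g]
  have "isCont (\<lambda>s. pairing (\<lambda>x. g (x - (clock t - clock s))) \<nu>) s" for s
    unfolding continuous_at_sequentially
  proof (intro allI impI)
    fix X :: "nat \<Rightarrow> real" assume X: "X \<longlonglongrightarrow> s"
    have cl: "(\<lambda>n. clock (X n)) \<longlonglongrightarrow> clock s"
      using isCont_tendsto_compose[OF DERIV_isCont[OF clock(2)] X] .
    have "(\<lambda>n. pairing (\<lambda>x. g (x - (clock t - clock (X n)))) \<nu>) \<longlonglongrightarrow> pairing (\<lambda>x. g (x - (clock t - clock s))) \<nu>"
      unfolding pairing_def
    proof (rule integral_dominated_convergence[where w="\<lambda>_. B"])
      show "AE x in \<nu>. (\<lambda>n. g (x - (clock t - clock (X n)))) \<longlonglongrightarrow> g (x - (clock t - clock s))"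
        using g(1) by (intro AE_I2 isCont_tendsto_compose[of _ g] tendsto_intros cl)
          (auto simp: continuous_on_eq_continuous_at)
    qed (use g(2) integrable_bounded_continuous[OF \<nu>_finite bc] in
        \<open>auto intro: borel_measurable_integrable\<close>)
    then show "((\<lambda>s. pairing (\<lambda>x. g (x - (clock t - clock s))) \<nu>) \<circ> X) \<longlonglongrightarrow> pairing (\<lambda>x. g (x - (clock t - clock s))) \<nu>"
      by (simp add: comp_def)
  qed
  then show ?thesis by (intro continuous_at_imp_continuous_on) auto
qed

lemma transport:
  fixes g g' :: "real \<Rightarrow> real"
  assumes d: "\<And>x. (g has_real_derivative g' x) (at x)"
    and neg: "\<And>x. x \<le> 0 \<Longrightarrow> g x = 0" "\<And>x. x \<le> 0 \<Longrightarrow> g' x = 0"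
    and b: "\<And>x. \<bar>g x\<bar> \<le> B" "\<And>x. \<bar>g' x\<bar> \<le> B'"
    and lip: "\<And>x y. \<bar>g' x - g' y\<bar> \<le> L * \<bar>x - y\<bar>"
    and t: "0 \<le> t"
  shows "pairing g (\<mu> t) = pairing (\<lambda>x. g (x - clock t)) (\<mu> 0)
    + \<alpha> * (LBINT s:{0..t}. pairing (\<lambda>x. g (x - (clock t - clock s))) \<nu>)"
proof -
  let ?G = "\<lambda>s. pairing (\<lambda>x. g (x - (clock t - clock s))) \<nu>"
  have gc: "continuous_on UNIV g"
    using d by (intro DERIV_continuous_on) (auto intro: has_field_derivative_at_within)
  have "((\<lambda>s. \<alpha> * ?G s) has_integral
      pairing (\<lambda>x. g (x - (clock t - clock t))) (\<mu> t) - pairing (\<lambda>x. g (x - (clock t - clock 0))) (\<mu> 0)) {0..t}"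
    using transport_derivative[OF d neg b lip]
    by (intro fundamental_theorem_of_calculus t)
      (auto simp: has_real_derivative_iff_has_vector_derivative)
  moreover have si: "set_integrable lborel {0..t} (\<lambda>s. \<alpha> * ?G s)"
    by (intro borel_integrable_atLeastAtMost' continuous_intros arrivals_continuous[OF gc b(1)])
  have "((\<lambda>s. \<alpha> * ?G s) has_integral (LBINT s:{0..t}. \<alpha> * ?G s)) {0..t}"
    unfolding set_borel_integral_eq_integral(2)[OF si]
    by (rule integrable_integral[OF set_borel_integral_eq_integral(1)[OF si]])
  ultimately have "pairing g (\<mu> t) - pairing (\<lambda>x. g (x - clock t)) (\<mu> 0) = (LBINT s:{0..t}. \<alpha> * ?G s)"
    by (auto dest: has_integral_unique simp: clock(1))
  then show ?thesis by simp
qed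

text \<open>Soft steps located at x and of growing steepness are inserted into
  \<open>transport\<close>. Since x >= 0 they vanish on the negative axis, and dominated convergence
  turns every pairing into a tail.\<close>

lemma ccdf_equation:
  assumes x: "0 \<le> x" and t: "0 \<le> t"
  shows "ccdf (\<mu> t) x = ccdf (\<mu> 0) (x + clock t)
    + \<alpha> * (LBINT s:{0..t}. ccdf \<nu> (x + clock t - clock s))"
proof -
  interpret prob_space \<nu> using crit by (simp add: critical_data_def)
  note [measurable] = ccdf_measurable[OF \<nu>_finite]
  define g where "g n y = soft_step (real (Suc n) * (y - x))" for n y
  define g' where "g' n y = real (Suc n) * soft_step' (real (Suc n) * (y - x))" for n y
  have d: "(g n has_real_derivative g' n y) (at y)" for n y
  proof -
    have "((\<lambda>y. real (Suc n) * (y - x)) has_real_derivative real (Suc n)) (at y)"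
      by (auto intro!: derivative_eq_intros)
    from DERIV_chain2[OF soft_step_deriv this] show ?thesis
      by (simp add: g_def[abs_def] g'_def mult.commute)
  qed
  have neg: "g n y = 0" "g' n y = 0" if "y \<le> 0" for n y
  proof -
    have "real (Suc n) * (y - x) \<le> 0" using that x by (intro mult_nonneg_nonpos) auto
    then show "g n y = 0" "g' n y = 0"
      by (simp_all only: g_def g'_def soft_step_def soft_step'_def max_absorb1) auto
  qed
  have b: "\<bar>g n y\<bar> \<le> 1" "\<bar>g' n y\<bar> \<le> real (Suc n)" for n y
    using soft_step_bounds(3) mult_left_mono[OF soft_step'_bound, of "real (Suc n)"]
    by (auto simp: g_def g'_def abs_mult)
  have lip: "\<bar>g' n y - g' n z\<bar> \<le> (2 * (real (Suc n))\<^sup>2) * \<bar>y - z\<bar>" for n y z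
  proof -
    have "\<bar>g' n y - g' n z\<bar> = real (Suc n) * \<bar>soft_step' (real (Suc n) * (y - x)) - soft_step' (real (Suc n) * (z - x))\<bar>"
      by (simp add: g'_def right_diff_distrib[symmetric] abs_mult del: of_nat_Suc)
    also have "\<dots> \<le> real (Suc n) * (2 * \<bar>real (Suc n) * (y - x) - real (Suc n) * (z - x)\<bar>)"
      by (intro mult_left_mono soft_step'_lipschitz) simp
    also have "\<dots> = (2 * (real (Suc n))\<^sup>2) * \<bar>y - z\<bar>"
      by (simp add: right_diff_distrib[symmetric] abs_mult power2_eq_square del: of_nat_Suc)
    finally show ?thesis .
  qed
  have gc: "continuous_on UNIV (g n)" for n
    using d by (intro DERIV_continuous_on) (auto intro: has_field_derivative_at_within)
  let ?G = "\<lambda>n s. pairing (\<lambda>y. g n (y - (clock t - clock s))) \<nu>"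
  have shift: "(\<lambda>n. pairing (\<lambda>y. g n (y - c)) M) \<longlonglongrightarrow> ccdf M (x + c)"
    if "M \<in> finite_measures" "0 \<le> c" for M c
    using pairing_soft_step_tendsto[OF that(1), of "x + c"] x that(2) by (simp add: g_def algebra_simps)
  have G1: "\<bar>?G n s\<bar> \<le> 1" for n s
    using pairing_bound[OF \<nu>_finite shift_bounded_continuous[OF gc b(1)] b(1)] prob_space
    by (simp add: total_mass_eq[OF \<nu>_finite] space_finite_measures[OF \<nu>_finite])
  have "(\<lambda>n. LBINT s:{0..t}. ?G n s) \<longlonglongrightarrow> (LBINT s:{0..t}. ccdf \<nu> (x + (clock t - clock s)))"
    unfolding set_lebesgue_integral_def
  proof (rule integral_dominated_convergence[where w="indicator {0..t}"])
    have [measurable]: "clock \<in> borel_measurable borel"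
      by (rule borel_measurable_continuous_onI[OF clock_continuous])
    show "(\<lambda>s. indicator {0..t} s *\<^sub>R ccdf \<nu> (x + (clock t - clock s))) \<in> borel_measurable lborel"
      by measurable
    show "(\<lambda>s. indicator {0..t} s *\<^sub>R ?G n s) \<in> borel_measurable lborel" for n
    proof -
      have [measurable]: "?G n \<in> borel_measurable borel"
        by (rule borel_measurable_continuous_onI[OF arrivals_continuous[OF gc b(1)]])
      show ?thesis by measurable
    qed
    show "integrable lborel (indicator {0..t} :: real \<Rightarrow> real)"
      by (rule integrable_real_indicator) (auto simp: emeasure_lborel_Icc_eq)
    show "AE s in lborel. (\<lambda>n. indicator {0..t} s *\<^sub>R ?G n s) \<longlonglongrightarrow> indicator {0..t} s *\<^sub>R ccdf \<nu> (x + (clock t - clock s))"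
      using shift[OF \<nu>_finite] clock_mono
      by (intro AE_I2) (auto split: split_indicator)
    show "AE s in lborel. norm (indicator {0..t} s *\<^sub>R ?G n s) \<le> indicator {0..t} s" for n
      using G1 by (intro AE_I2) (auto split: split_indicator)
  qed
  then have "(\<lambda>n. pairing (\<lambda>y. g n (y - clock t)) (\<mu> 0) + \<alpha> * (LBINT s:{0..t}. ?G n s)) \<longlonglongrightarrow>
    ccdf (\<mu> 0) (x + clock t) + \<alpha> * (LBINT s:{0..t}. ccdf \<nu> (x + (clock t - clock s)))"
    using clock_mono[OF t] clock(1) by (intro tendsto_intros shift \<mu>_finite) auto
  moreover have "pairing (\<lambda>y. g n (y - clock t)) (\<mu> 0) + \<alpha> * (LBINT s:{0..t}. ?G n s) = pairing (\<lambda>y. g n (y - 0)) (\<mu> t)" for n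
    using transport[OF d neg b lip t, of n] by simp
  ultimately have "(\<lambda>n. pairing (\<lambda>y. g n (y - 0)) (\<mu> t)) \<longlonglongrightarrow>
    ccdf (\<mu> 0) (x + clock t) + \<alpha> * (LBINT s:{0..t}. ccdf \<nu> (x + (clock t - clock s)))" by simp
  with shift[OF \<mu>_finite[OF t], of 0] show ?thesis
    using LIMSEQ_unique by (fastforce simp: add_diff_eq)
qed

lemma ccdf_\<nu>_le: "ccdf \<nu> x \<le> 1"
  using ccdf_antimono[OF \<nu>_finite, of 0 "max 0 x"] critical_data_pos(3)[OF crit] by (simp add: ccdf_def)

lemma mass_eq: "0 \<le> t \<Longrightarrow> mass t = ccdf (\<mu> t) 0"
  using ccdf_0[OF \<mu>_finite no_mass_at_0] by (simp add: mass_def)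

text \<open>Initial jobs can only leave, and arrivals up to t amount to at most \<alpha> * t, every
  tail of \<nu> being at most 1.\<close>

lemma mass_le: "0 \<le> t \<Longrightarrow> mass t \<le> mass 0 + \<alpha> * t"
proof -
  assume t: "0 \<le> t"
  note [measurable] = ccdf_measurable[OF \<nu>_finite]
  have [measurable]: "clock \<in> borel_measurable borel"
    by (rule borel_measurable_continuous_onI[OF clock_continuous])
  have ii: "integrable lborel (indicator {0..t} :: real \<Rightarrow> real)"
    by (rule integrable_real_indicator) (auto simp: emeasure_lborel_Icc_eq)
  have "(LBINT s:{0..t}. ccdf \<nu> (0 + clock t - clock s)) \<le> (LBINT s:{0..t}. 1)"
  proof (rule set_integral_mono)
    show "set_integrable lborel {0..t} (\<lambda>s. ccdf \<nu> (0 + clock t - clock s))"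
      unfolding set_integrable_def
      by (rule Bochner_Integration.integrable_bound[OF ii])
        (auto simp: ccdf_nonneg ccdf_\<nu>_le split: split_indicator)
  qed (use ii ccdf_\<nu>_le in \<open>auto simp: set_integrable_def\<close>)
  also have "\<dots> = t" using t by (simp add: set_lebesgue_integral_def)
  finally have "\<alpha> * (LBINT s:{0..t}. ccdf \<nu> (0 + clock t - clock s)) \<le> \<alpha> * t"
    using critical_data_pos(1)[OF crit] by (intro mult_left_mono) auto
  moreover have "ccdf (\<mu> 0) (0 + clock t) \<le> mass 0"
    using clock_mono[OF t] clock(1) ccdf_antimono[OF \<mu>_finite, of 0 0 "clock t"] by (simp add: mass_eq)
  ultimately show ?thesis
    using ccdf_equation[of 0 t] t by (simp add: mass_eq)
qed

text \<open>The mass grows at most linearly, so the clock, with rate 1 / \<open>mass\<close>, grows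
  at least logarithmically. The comparison function \<open>?l\<close> is the integral of 1 / (mass 0
  + \<alpha> * s) over [0, t].\<close>

lemma clock_at_top: "filterlim clock at_top at_top"
proof (rule filterlim_at_top_mono)
  note \<alpha> = critical_data_pos(1)[OF crit]
  let ?l = "\<lambda>t. (ln (mass 0 + \<alpha> * t) - ln (mass 0)) / \<alpha>"
  have "filterlim (\<lambda>t. mass 0 + \<alpha> * t) at_top at_top"
    using \<alpha> by (intro filterlim_tendsto_add_at_top[OF tendsto_const] filterlim_tendsto_pos_mult_at_top[OF tendsto_const _ filterlim_ident])
  then have "filterlim (\<lambda>t. ln (mass 0 + \<alpha> * t)) at_top at_top"
    by (rule filterlim_compose[OF ln_at_top])
  then have "filterlim (\<lambda>t. (1 / \<alpha>) * (- ln (mass 0) + ln (mass 0 + \<alpha> * t))) at_top at_top"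
    using \<alpha> by (intro filterlim_tendsto_pos_mult_at_top[OF tendsto_const] filterlim_tendsto_add_at_top[OF tendsto_const]) auto
  then show "filterlim ?l at_top at_top" by (simp add: algebra_simps diff_divide_distrib)
  have "?l t \<le> clock t" if t: "0 \<le> t" for t
  proof -
    have "clock 0 - ?l 0 \<le> clock t - ?l t"
    proof (rule DERIV_nonneg_imp_nondecreasing[OF t])
      fix s assume s: "0 \<le> s" "s \<le> t"
      have pos: "0 < mass 0 + \<alpha> * s" using mass_pos[of 0] \<alpha> s by (simp add: add_pos_nonneg)
      then have "((\<lambda>t. ln (mass 0 + \<alpha> * t) - ln (mass 0)) has_real_derivative \<alpha> / (mass 0 + \<alpha> * s)) (at s)"
        by (auto intro!: derivative_eq_intros)
      from DERIV_diff[OF clock(2) DERIV_cdivide[OF this, of \<alpha>]]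
      have "((\<lambda>t. clock t - ?l t) has_real_derivative 1 / mass s - 1 / (mass 0 + \<alpha> * s)) (at s)"
        using \<alpha> by simp
      moreover have "0 \<le> 1 / mass s - 1 / (mass 0 + \<alpha> * s)"
        using mass_le[OF s(1)] mass_pos[of s] by (simp add: frac_le)
      ultimately show "\<exists>y. ((\<lambda>t. clock t - ?l t) has_real_derivative y) (at s) \<and> 0 \<le> y" by blast
    qed
    then show ?thesis by (simp add: clock(1))
  qed
  then show "\<forall>\<^sub>F t in at_top. ?l t \<le> clock t"
    by (intro eventually_mono[OF eventually_ge_at_top[of 0]])
qed

end

section \<open>Time change and convergence\<close>

context fluid_solution begin

definition unclock :: "real \<Rightarrow> real" where
  "unclock u = inv_into {0..} clock (max 0 u)"

text \<open>By divergence of the clock and the intermediate value theorem, every nonnegative clock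
  value is attained at a nonnegative time.\<close>

lemma clock_unclock: "0 \<le> unclock u" "clock (unclock u) = max 0 u"
proof -
  have "max 0 u \<in> clock ` {0..}"
  proof -
    have "\<forall>\<^sub>F t in at_top. max 0 u \<le> clock t \<and> 0 \<le> t"
      by (rule eventually_conj[OF filterlim_at_top[THEN iffD1, OF clock_at_top, rule_format] eventually_ge_at_top])
    then obtain t where t: "max 0 u \<le> clock t" "0 \<le> t"
      using eventually_happens'[OF trivial_limit_at_top_linorder] by blast
    have "\<exists>s\<ge>0. s \<le> t \<and> clock s = max 0 u"
      by (rule IVT') (use t clock(1) clock_continuous in auto)
    then show ?thesis by force
  qed
  then show "0 \<le> unclock u" "clock (unclock u) = max 0 u"
    using inv_into_into[of "max 0 u" clock "{0..}"] by (auto simp: unclock_def f_inv_into_f)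
qed

lemma unclock_clock: "0 \<le> t \<Longrightarrow> unclock (clock t) = t"
  using clock_unclock[of "clock t"] clock_strict_mono[of "unclock (clock t)" t]
    clock_strict_mono[of t "unclock (clock t)"] clock_mono[of 0 t] clock(1)
  by (cases "unclock (clock t)" t rule: linorder_cases) auto

lemma unclock_mono: "mono unclock"
proof (rule monoI, rule ccontr)
  fix u v :: real assume "u \<le> v" "\<not> unclock u \<le> unclock v"
  then show False
    using clock_strict_mono[of "unclock v" "unclock u"] by (auto simp: clock_unclock)
qed

text \<open>This is the m of the overview. Being 0 before clock value 0, it cuts the convolution off
  at the current clock value.\<close>

definition clocked_mass :: "real \<Rightarrow> real" where
  "clocked_mass u = indicator {0..} u * mass (unclock u)"

lemma mass_measurable[measurable]: "mass \<in> borel_measurable borel"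
  by (rule borel_measurable_continuous_onI[OF mass_continuous])

lemma clock_measurable[measurable]: "clock \<in> borel_measurable borel"
  by (rule borel_measurable_continuous_onI[OF clock_continuous])

lemma clocked_mass_measurable[measurable]: "clocked_mass \<in> borel_measurable borel"
proof -
  have [measurable]: "unclock \<in> borel_measurable borel"
    by (rule borel_measurable_mono[OF unclock_mono])
  show ?thesis unfolding clocked_mass_def[abs_def] by measurable
qed

lemma clocked_mass_nonneg: "0 \<le> clocked_mass u"
  using mass_pos[of "unclock u"] by (simp add: clocked_mass_def)

lemma clocked_mass_neg: "u < 0 \<Longrightarrow> clocked_mass u = 0"
  by (simp add: clocked_mass_def)

lemma clocked_mass_clock: "0 \<le> t \<Longrightarrow> clocked_mass (clock t) = mass t"
  using clock_mono[of 0 t] clock(1) by (simp add: clocked_mass_def unclock_clock)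

lemma clocked_mass_locally_bounded: "\<exists>B. \<forall>u\<le>U. clocked_mass u \<le> B"
proof -
  have "compact (mass ` {0..unclock U})"
    by (intro compact_continuous_image continuous_on_subset[OF mass_continuous]) auto
  then have "bdd_above (mass ` {0..unclock U})"
    by (intro bounded_imp_bdd_above compact_imp_bounded)
  then obtain B where B: "\<And>s. s \<in> {0..unclock U} \<Longrightarrow> mass s \<le> B"
    unfolding bdd_above_def by blast
  have "clocked_mass u \<le> B" if "u \<le> U" for u
  proof -
    have "mass (unclock u) \<le> B"
      using monoD[OF unclock_mono that] clock_unclock(1) by (intro B) auto
    moreover have "clocked_mass u \<le> mass (unclock u)"
      using mass_pos[of "unclock u"] by (auto simp: clocked_mass_def split: split_indicator)
    ultimately show ?thesis by simp
  qed
  then show ?thesis by blast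
qed

text \<open>In the tail equation the substitution v = clock s has dv = ds / mass s, so the time
  integral acquires the factor \<open>mass\<close>. This is how the unknown enters and a linear
  renewal equation arises.\<close>

lemma clocked_equation:
  assumes x: "0 \<le> x" and t: "0 \<le> t"
  shows "ennreal (ccdf (\<mu> t) x) = ennreal (ccdf (\<mu> 0) (x + clock t)) +
    (\<integral>\<^sup>+s. indicator {0..} s * ennreal (\<alpha> * ccdf \<nu> (x + s) * clocked_mass (clock t - s)) \<partial>lborel)"
proof -
  note [measurable] = ccdf_measurable[OF \<nu>_finite]
  note \<alpha> = critical_data_pos(1)[OF crit]
  let ?u = "clock t"
  define F where "F v = \<alpha> * ccdf \<nu> (x + ?u - v) * clocked_mass v" for v
  have Fm[measurable]: "F \<in> borel_measurable borel" unfolding F_def[abs_def] by measurable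
  have ii: "integrable lborel (indicator {0..t} :: real \<Rightarrow> real)"
    by (rule integrable_real_indicator) (auto simp: emeasure_lborel_Icc_eq)
  have int: "integrable lborel (\<lambda>s. indicator {0..t} s * ccdf \<nu> (x + ?u - clock s))"
    by (rule Bochner_Integration.integrable_bound[OF ii])
      (auto simp: ccdf_nonneg ccdf_\<nu>_le split: split_indicator)
  have I0: "0 \<le> (LBINT s:{0..t}. ccdf \<nu> (x + ?u - clock s))"
    unfolding set_lebesgue_integral_def by (intro integral_nonneg_AE) (auto simp: ccdf_nonneg)
  have "ennreal (\<alpha> * (LBINT s:{0..t}. ccdf \<nu> (x + ?u - clock s))) =
    (\<integral>\<^sup>+s. ennreal (\<alpha> * (indicator {0..t} s * ccdf \<nu> (x + ?u - clock s))) \<partial>lborel)"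
    using int \<alpha> by (subst nn_integral_eq_integral) (auto simp: ccdf_nonneg set_lebesgue_integral_def)
  \<comment> \<open>The factor mass s inside F (clock s) is cancelled by 1 / mass s, which is the
    derivative of the clock required by the substitution rule.\<close>
  also have "\<dots> = (\<integral>\<^sup>+s. ennreal (F (clock s) * (1 / mass s) * indicator {0..t} s) \<partial>lborel)"
    using mass_pos by (intro nn_integral_cong)
      (auto simp: F_def clocked_mass_clock less_imp_neq[symmetric] order_less_imp_not_eq2 split: split_indicator)
  also have "\<dots> = (\<integral>\<^sup>+v. ennreal (F v * indicator {clock 0..clock t} v) \<partial>lborel)"
    using mass_pos
    by (intro nn_integral_substitution[symmetric] clock(2) continuous_intros continuous_on_subset[OF mass_continuous] t)
      (auto simp: less_imp_le less_imp_neq[symmetric] order_less_imp_not_eq2 set_borel_measurable_def)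
  also have "\<dots> = (\<integral>\<^sup>+v. indicator {0..} (?u - v) * ennreal (F v) \<partial>lborel)"
    using clocked_mass_neg by (intro nn_integral_cong) (auto simp: clock(1) F_def not_le split: split_indicator)
  also have "\<dots> = (\<integral>\<^sup>+s. indicator {0..} s * ennreal (F (?u - s)) \<partial>lborel)"
    by (subst nn_integral_real_affine[where c="-1" and t="?u"]) auto
  finally have "ennreal (\<alpha> * (LBINT s:{0..t}. ccdf \<nu> (x + ?u - clock s))) =
    (\<integral>\<^sup>+s. indicator {0..} s * ennreal (F (?u - s)) \<partial>lborel)" .
  then show ?thesis
    unfolding ccdf_equation[OF x t] using \<alpha> I0 by (simp add: F_def ccdf_nonneg)
qed

section \<open>The limit of the mass, of the tails and of all pairings\<close>

definition density_e :: "real \<Rightarrow> real" where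
  "density_e x = indicator {0..} x * (\<alpha> * ccdf \<nu> x)"

sublocale excess: renewal_density density_e
  unfolding density_e_def[abs_def] by (rule critical_data_renewal_density[OF crit])

lemma first_moment_excess:
  "first_moment (excess_measure \<alpha> \<nu>) = (\<integral>\<^sup>+s. indicator {0..} s * ennreal (excess.tail s) \<partial>lborel)"
  unfolding nn_integral_ccdf[OF excess_measure_props(1)[OF crit], symmetric]
    excess_measure_props(3)[OF crit, folded density_e_def]
  by (intro nn_integral_cong) (auto split: split_indicator)

definition limit_mass :: real where
  "limit_mass = enn2real (beta_e \<alpha> \<nu> * first_moment (\<mu> 0))"

lemma excess_moment_pos: "0 < first_moment (excess_measure \<alpha> \<nu>)"
proof (rule first_moment_pos[OF excess_measure_props(1)[OF crit]])
  have "0 < excess.tail 0"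
    using excess.tail_strict excess.tail_antimono by (metis less_imp_le less_le_trans)
  then show "0 < measure (excess_measure \<alpha> \<nu>) {0<..}"
    using excess_measure_props(3)[OF crit, of 0] by (simp add: ccdf_def density_e_def[abs_def])
qed

text \<open>The convention for an infinite mean agrees with 1 / infinity = 0 in
  \<open>ennreal\<close>.\<close>

lemma beta_e_eq: "beta_e \<alpha> \<nu> = 1 / first_moment (excess_measure \<alpha> \<nu>)"
  by (auto simp: beta_e_def)

text \<open>A positive excess mean excludes division by 0, so the product is finite and
  \<open>enn2real\<close> loses nothing.\<close>

lemma limit_mass_ennreal: "beta_e \<alpha> \<nu> * first_moment (\<mu> 0) = ennreal limit_mass"
proof -
  have "beta_e \<alpha> \<nu> \<noteq> \<top>" using excess_moment_pos by (auto simp: beta_e_eq ennreal_divide_eq_top_iff)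
  then have "beta_e \<alpha> \<nu> * first_moment (\<mu> 0) < \<top>"
    using moment0 by (auto simp: ennreal_mult_eq_top_iff less_top[symmetric])
  then show ?thesis by (simp add: limit_mass_def)
qed

text \<open>At x = 0 the clocked equation closes up: without an atom at 0 the tail at 0 is the total
  mass. The workload constant is the integral of the initial tail, which is the first
  moment.\<close>

lemma clocked_mass_limit:
  "\<exists>B. \<forall>u. clocked_mass u \<le> B" "(clocked_mass \<longlongrightarrow> limit_mass) at_top"
proof -
  define z where "z = ccdf (\<mu> 0)"
  define w where "w = enn2real (first_moment (\<mu> 0))"
  have w: "ennreal w = first_moment (\<mu> 0)" "0 \<le> w" using moment0 by (auto simp: w_def)
  have zm: "z \<in> borel_measurable borel" unfolding z_def by (rule ccdf_measurable[OF \<mu>_finite]) simp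
  have z: "0 \<le> z y" "z y \<le> z 0" for y
    using ccdf_antimono[OF \<mu>_finite, of 0 0 "max 0 y"] by (auto simp: z_def ccdf_nonneg ccdf_def)
  have zl: "(z \<longlongrightarrow> 0) at_top" unfolding z_def by (rule ccdf_at_top[OF \<mu>_finite]) simp
  have zi: "(\<integral>\<^sup>+y. indicator {0..} y * ennreal (z y) \<partial>lborel) = ennreal w"
    unfolding z_def w by (rule nn_integral_ccdf[OF \<mu>_finite]) simp
  have eq: "ennreal (clocked_mass y) = ennreal (z y) + (\<integral>\<^sup>+s. ennreal (density_e s * clocked_mass (y - s)) \<partial>lborel)"
    if y: "0 \<le> y" for y
  proof -
    have cl: "clock (unclock y) = y" using y by (simp add: clock_unclock)
    have "(\<integral>\<^sup>+s. indicator {0..} s * ennreal (\<alpha> * ccdf \<nu> (0 + s) * clocked_mass (y - s)) \<partial>lborel) =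
      (\<integral>\<^sup>+s. ennreal (density_e s * clocked_mass (y - s)) \<partial>lborel)"
      by (intro nn_integral_cong) (auto simp: density_e_def split: split_indicator)
    then show ?thesis
      using clocked_equation[of 0 "unclock y"] mass_eq[of "unclock y"] y
      by (simp add: cl clock_unclock clocked_mass_def z_def)
  qed
  note R = excess.renewal_theorem[OF clocked_mass_measurable zm clocked_mass_nonneg clocked_mass_neg
      clocked_mass_locally_bounded z zl zi w(2) eq]
  show "\<exists>B. \<forall>u. clocked_mass u \<le> B" by (rule R(1))
  have "beta_e \<alpha> \<nu> * first_moment (\<mu> 0) = ennreal w / (\<integral>\<^sup>+s. indicator {0..} s * ennreal (excess.tail s) \<partial>lborel)"
    unfolding beta_e_eq first_moment_excess[symmetric] w(1)
    by (simp add: ennreal_times_divide mult.commute)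
  with R(2) show "(clocked_mass \<longlongrightarrow> limit_mass) at_top" by (simp add: limit_mass_def)
qed

text \<open>Given the limit of the clocked mass, dominated convergence in
  \<open>clocked_equation\<close> multiplies it by the integral of the excess density beyond x; the
  initial tail dies out.\<close>

lemma ccdf_limit:
  assumes x: "0 \<le> x"
  shows "((\<lambda>t. ccdf (\<mu> t) x) \<longlongrightarrow> limit_mass * ccdf (excess_measure \<alpha> \<nu>) x) at_top"
proof -
  note [measurable] = ccdf_measurable[OF \<nu>_finite]
  note \<alpha> = critical_data_pos(1)[OF crit]
  obtain B where B: "\<And>u. clocked_mass u \<le> B" using clocked_mass_limit(1) by blast
  define p where "p s = indicator {0..} s * density_e (x + s)" for s
  have p0: "0 \<le> p s" for s by (simp add: p_def excess.f_nonneg)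
  have "integrable lborel (\<lambda>s. density_e (x + s))"
    using lborel_integrable_real_affine[OF excess.f_integrable, of 1 x] by simp
  then have pint: "integrable lborel p"
    using integrable_mult_indicator[of "{0..}" lborel "\<lambda>s. density_e (x + s)"] by (simp add: p_def[abs_def])
  then have pm[measurable]: "p \<in> borel_measurable borel" by auto
  have ptail: "(LINT s|lborel. p s) = excess.tail x"
  proof -
    have "excess.tail x = (LINT s|lborel. indicator {x<..} (x + s) * density_e (x + s))"
      unfolding excess.tail_def by (subst lborel_integral_real_affine[where c=1 and t=x]) auto
    \<comment> \<open>Open and closed half-line differ only at s = 0, a null set.\<close>
    also have "\<dots> = (LINT s|lborel. p s)"
    proof (rule integral_cong_AE)
      show "AE s in lborel. indicator {x<..} (x + s) * density_e (x + s) = p s"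
        using AE_lborel_singleton[of "0::real"]
        by (rule AE_mp) (auto simp: p_def intro!: AE_I2 split: split_indicator)
    qed auto
    finally show ?thesis ..
  qed
  have bnd: "\<bar>p s * clocked_mass v\<bar> \<le> B * p s" for s v
    using mult_left_mono[OF B[of v] p0[of s]] p0[of s] clocked_mass_nonneg[of v]
    by (simp add: abs_mult mult.commute)
  have eq: "ccdf (\<mu> t) x = ccdf (\<mu> 0) (x + clock t) + (LINT s|lborel. p s * clocked_mass (clock t - s))" if t: "0 \<le> t" for t
  proof -
    have int: "integrable lborel (\<lambda>s. p s * clocked_mass (clock t - s))"
      by (rule Bochner_Integration.integrable_bound[OF integrable_mult_right[OF pint, of B]])
        (use bnd in \<open>auto intro: order.trans[OF bnd abs_ge_self]\<close>)
    have "(\<integral>\<^sup>+s. indicator {0..} s * ennreal (\<alpha> * ccdf \<nu> (x + s) * clocked_mass (clock t - s)) \<partial>lborel)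
      = (\<integral>\<^sup>+s. ennreal (p s * clocked_mass (clock t - s)) \<partial>lborel)"
      using x by (intro nn_integral_cong) (auto simp: p_def density_e_def split: split_indicator)
    also have "\<dots> = ennreal (LINT s|lborel. p s * clocked_mass (clock t - s))"
      using p0 clocked_mass_nonneg by (intro nn_integral_eq_integral int) auto
    finally have "ennreal (ccdf (\<mu> t) x) = ennreal (ccdf (\<mu> 0) (x + clock t)) + ennreal (LINT s|lborel. p s * clocked_mass (clock t - s))"
      using clocked_equation[OF x t] by simp
    moreover have "0 \<le> (LINT s|lborel. p s * clocked_mass (clock t - s))"
      using p0 clocked_mass_nonneg by (intro integral_nonneg_AE) auto
    ultimately show ?thesis
      by (simp add: ccdf_nonneg ennreal_plus[symmetric] del: ennreal_plus)
  qed
  have "((\<lambda>u. LINT s|lborel. p s * clocked_mass (u - s)) \<longlongrightarrow> (LINT s|lborel. p s * limit_mass)) at_top"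
  proof (rule integral_dominated_convergence_at_top[where w="\<lambda>s. B * p s"])
    show "AE s in lborel. ((\<lambda>u. p s * clocked_mass (u - s)) \<longlongrightarrow> p s * limit_mass) at_top"
    proof (intro AE_I2 tendsto_mult tendsto_const filterlim_compose[OF clocked_mass_limit(2)])
      show "filterlim (\<lambda>u. u - s) at_top at_top" for s :: real
        using filterlim_tendsto_add_at_top[OF tendsto_const filterlim_ident, of "- s"] by simp
    qed
    show "\<forall>\<^sub>F u in at_top. AE s in lborel. norm (p s * clocked_mass (u - s)) \<le> B * p s"
      using bnd by simp
  qed (use pint in auto)
  then have "((\<lambda>t. LINT s|lborel. p s * clocked_mass (clock t - s)) \<longlongrightarrow> (LINT s|lborel. p s * limit_mass)) at_top"
    by (rule filterlim_compose[OF _ clock_at_top])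
  moreover have "((\<lambda>t. ccdf (\<mu> 0) (x + clock t)) \<longlongrightarrow> 0) at_top"
    by (rule filterlim_compose[OF ccdf_at_top[OF \<mu>_finite] filterlim_tendsto_add_at_top[OF tendsto_const clock_at_top]]) simp
  ultimately have lim: "((\<lambda>t. ccdf (\<mu> 0) (x + clock t) + (LINT s|lborel. p s * clocked_mass (clock t - s)))
      \<longlongrightarrow> 0 + (LINT s|lborel. p s * limit_mass)) at_top"
    by (rule tendsto_add[rotated])
  have lim_eq: "0 + (LINT s|lborel. p s * limit_mass) = limit_mass * ccdf (excess_measure \<alpha> \<nu>) x"
    using x ptail excess_measure_props(3)[OF crit, of x] by (simp add: density_e_def[abs_def] mult.commute)
  have "\<forall>\<^sub>F t in at_top. ccdf (\<mu> 0) (x + clock t) + (LINT s|lborel. p s * clocked_mass (clock t - s)) = ccdf (\<mu> t) x"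
    using eventually_ge_at_top[of 0] by eventually_elim (rule eq[symmetric])
  with lim[unfolded lim_eq] show ?thesis by (rule Lim_transform_eventually)
qed

text \<open>The values of \<mu> at negative arguments are arbitrary, and
  \<open>pairing_tendsto\<close> requires finite measures along the whole sequence; hence the detour
  through max 0 t, which changes nothing eventually.\<close>

lemma pairing_limit:
  assumes g: "g \<in> bounded_continuous"
  shows "((\<lambda>t. pairing g (\<mu> t)) \<longlongrightarrow> limit_mass * pairing g (excess_measure \<alpha> \<nu>)) at_top"
proof -
  have "((\<lambda>t. pairing g (\<mu> (max 0 t))) \<longlongrightarrow> limit_mass * pairing g (excess_measure \<alpha> \<nu>)) at_top"
  proof (rule tendsto_at_topI_sequentially)
    fix X :: "nat \<Rightarrow> real" assume X: "filterlim X at_top sequentially"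
    have mX: "filterlim (\<lambda>n. max 0 (X n)) at_top sequentially"
      by (rule filterlim_at_top_mono[OF X]) auto
    have "(\<lambda>n. clocked_mass (clock (max 0 (X n)))) \<longlonglongrightarrow> limit_mass"
      by (intro filterlim_compose[OF clocked_mass_limit(2)] filterlim_compose[OF clock_at_top] mX)
    then have "(\<lambda>n. total_mass (\<mu> (max 0 (X n)))) \<longlonglongrightarrow> limit_mass"
      by (simp add: clocked_mass_clock mass_def)
    then show "(\<lambda>n. pairing g (\<mu> (max 0 (X n)))) \<longlonglongrightarrow> limit_mass * pairing g (excess_measure \<alpha> \<nu>)"
      using excess_measure_props[OF crit]
      by (intro pairing_tendsto filterlim_compose[OF ccdf_limit mX] g)
        (auto simp: \<mu>_finite never_extinct limit_mass_def)
  qed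
  moreover have "\<forall>\<^sub>F t in at_top. pairing g (\<mu> (max 0 t)) = pairing g (\<mu> t)"
    using eventually_ge_at_top[of 0] by eventually_elim simp
  ultimately show ?thesis by (rule Lim_transform_eventually)
qed

end

lemma scale_measure_finite_measures:
  assumes "M \<in> finite_measures"
  shows "scale_measure (ennreal c) M \<in> finite_measures"
proof -
  interpret finite_measure M using assms by (simp add: finite_measures_def)
  have "finite_measure (scale_measure (ennreal c) M)"
    by (rule finite_measureI) (simp add: space_scale_measure ennreal_mult_eq_top_iff)
  then show ?thesis using assms by (simp add: finite_measures_def)
qed

theorem theorem1p2:
  fixes \<alpha> :: real and \<nu> \<xi> :: "real measure" and \<mu> :: "real \<Rightarrow> real measure"
  assumes "critical_data \<alpha> \<nu>"
    and "\<xi> \<in> continuous_measures"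
    and "fluid_model_solution \<alpha> \<nu> \<mu>"
    and "\<mu> 0 = \<xi>"
    and "first_moment \<xi> < \<infinity>"
  shows "limitin weak_topology \<mu>
           (scale_measure (beta_e \<alpha> \<nu> * first_moment \<xi>) (excess_measure \<alpha> \<nu>)) at_top"
proof -
  note E = excess_measure_props(1)[OF assms(1)]
  have fin: "\<mu> t \<in> finite_measures" if "t \<in> {0..}" for t
    using continuous_map_funspace[of "top_of_set {0..}" weak_topology \<mu>] assms(3) that
    by (auto simp: fluid_model_solution_def topspace_weak_topology)
  \<comment> \<open>A common real limit mass c serves both the empty and the nonempty initial
    state.\<close>
  have "\<exists>c\<ge>0. beta_e \<alpha> \<nu> * first_moment \<xi> = ennreal c \<and>
    (\<forall>g\<in>bounded_continuous. ((\<lambda>t. pairing g (\<mu> t)) \<longlongrightarrow> c * pairing g (excess_measure \<alpha> \<nu>)) at_top)"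
  proof (cases "total_mass \<xi> = 0")
    case True
    \<comment> \<open>An empty start makes the extinction time at most 0, so the last clause of the
      fluid model forces mass 0 at every later time.\<close>
    have ext: "extinction_time \<mu> \<le> ereal t" if "0 \<le> t" for t
    proof -
      have "extinction_time \<mu> \<le> ereal 0"
        unfolding extinction_time_def using True assms(4) by (intro INF_lower) auto
      with that show ?thesis by (meson ereal_less_eq(3) order_trans)
    qed
    have zero: "pairing g (\<mu> t) = 0" if "0 \<le> t" and g: "g \<in> bounded_continuous" for g t
    proof -
      obtain B where "\<forall>x\<ge>0. \<bar>g x\<bar> \<le> B" using g by (auto simp: bounded_continuous_def bounded_iff)
      moreover have "total_mass (\<mu> t) = 0"
        using assms(3) ext that(1) by (simp add: fluid_model_solution_def)
      ultimately show ?thesis using pairing_bound[OF fin g, of t B] that(1) by simp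
    qed
    interpret finite_measure \<xi> using assms(2) by (simp add: continuous_measures_def finite_measures_def)
    have "space \<xi> \<in> null_sets \<xi>"
      using True by (simp add: total_mass_def pairing_def emeasure_eq_measure null_sets_def)
    then have "(\<integral>\<^sup>+x. ennreal x * indicator (space \<xi>) x \<partial>\<xi>) = 0"
      by (rule nn_integral_null_set)
    then have "first_moment \<xi> = 0"
      unfolding first_moment_def by (simp cong: nn_integral_cong)
    moreover have "((\<lambda>t. pairing g (\<mu> t)) \<longlongrightarrow> 0) at_top" if "g \<in> bounded_continuous" for g
      using zero[OF _ that] by (intro tendsto_eventually eventually_mono[OF eventually_ge_at_top[of 0]])
    ultimately show ?thesis by (intro exI[of _ 0]) auto
  next
    case False
    then have "0 < total_mass \<xi>" by (simp add: total_mass_def pairing_def less_le)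
    then interpret fluid_solution \<alpha> \<nu> \<mu>
      using assms by unfold_locales auto
    show ?thesis
      using limit_mass_ennreal pairing_limit assms(4)
      by (intro exI[of _ limit_mass]) (auto simp: limit_mass_def)
  qed
  then obtain c where c: "0 \<le> c" "beta_e \<alpha> \<nu> * first_moment \<xi> = ennreal c"
    "\<And>g. g \<in> bounded_continuous \<Longrightarrow> ((\<lambda>t. pairing g (\<mu> t)) \<longlongrightarrow> c * pairing g (excess_measure \<alpha> \<nu>)) at_top"
    by blast
  show ?thesis
    unfolding c(2)
  proof (subst limitin_weak_topology[where S="{0..}"])
    show "\<forall>\<^sub>F t in at_top. t \<in> {0::real..}" using eventually_ge_at_top[of 0] by simp
  qed (use fin c(1,3) in \<open>auto simp: pairing_scale_measure E scale_measure_finite_measures\<close>)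
qed

end
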